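(* Let $q\ge3$. For every cyclic group $G\subset F_q^*$ of order $r\ge 6$ and for every set $D\subset G$ such that $1\not\in D$, and such that $a^{-1}\not\in D$ whenever $a\in D$ and $a^{-1}\ne a$, there is a bounded extremal barrier for $D$; that is, there is a constant $K$ such that for every $\tau>0$ there is an extremal barrier $\mathcal B$ for $D$ with $|\mathcal B|\le K$ and with all points of all sequences $B(\chi)$ having imaginary part $\ge\tau$.
   Context: Let $q\ge 3$ be an integer, $F_q^*$ the multiplicative group of reduced residues modulo $q$, $\phi$ Euler's function, $C_q$ the set of non-principal Dirichlet characters modulo $q$, $\pi(x)$ the number of primes $\le x$. For complex $\rho$ with $\Re\rho>0$ and $x\ge 2$ put $$f(\rho)=\frac{x^{\rho}}{\rho\log x}+\frac1\rho\int_2^x\frac{t^\rho}{t\log^2 t}\,dt .$$ A system $\mathcal B$ (modulo $q$) assigns to each $\chi\in C_q$ a sequence $B(\chi)$ (possibly empty, repetitions allowed) of complex numbers with non-negative imaginary part; $n(\rho,\chi)$ is the number of occurrences of $\rho$ in $B(\chi)$ (0 if it does not occur). If $\rho$ is real it is required that $n(\rho,\chi)=n(\rho,\overline\chi)$. Put $R^+(\mathcal B)=\sup\{\Re\rho:\rho\in\mathcal B\}$, $R^-(\mathcal B)=\inf\{\Re\rho:\rho\in\mathcal B\}$. It is always assumed that $\frac12<R^-(\mathcal B)\le R^+(\mathcal B)\le 1$ and $\sum_{\chi\in C_q}\sum_{\rho\in B(\chi)} n(\rho,\chi)/|\rho|<\infty$ (sums are over distinct $\rho$). If all $B(\chi)$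 are finite, $|\mathcal B|$ is the total number of elements of the sequences $B(\chi)$, counted with multiplicity. Define $$P_{q,a}(x;\mathcal B)=-\frac{2}{\phi(q)}\Re\Big(\sum_{\chi\in C_q}\overline\chi(a)\sum_{\rho\in B(\chi)}w(\rho)\,n(\rho,\chi) f(\rho)\Big)+\frac{\pi(x)}{\phi(q)},$$ where the inner sum is over distinct $\rho$, $w(\rho)=\frac12$ if $\rho$ is real and $w(\rho)=1$ otherwise. A family $\mathcal F=(F_{q,a})_{a\in F_q^*}$ of functions $[0,\infty)\to\mathbb R$ is $\beta$-similar to $\mathcal P_q=(P_{q,a}(\cdot;\mathcal B))_{a\in F_q^*}$ if $|F_{q,a}(x)-P_{q,a}(x;\mathcal B)|=o(x^\beta/\log x)$ as $x\to\infty$ for every $a$. For a statement $\mathcal I(\mathcal F)$ about such families, $\mathcal B$ is a barrier for $\mathcal I$ if, with $\beta=R^-(\mathcal B)$, for every $\mathcal F$ that is $\beta$-similar to $\mathcal P_q$ the statement $\mathcal I(\mathcal F)$ is false. "For arbitrarily large $x$, $A(x)$" means the set of $x$ for which $A(x)$ holds is unbounded above. For $D=\{a_1,\dots,a_k\}\subseteq F_q^*$ (distinct $a_i$), an ordering of the functions $F_{q,a_i}$ is a chain $F_{q,a_{i(1)}}(x)\ge\dots\ge F_{q,a_{i(k)}}(x)$ with $(i(1),\dots,i(k))$ a permutation of $\{1,\dots,k\}$; it occurs at $x$ if these non-strict inequalities hold at $x$ (several orderings may occur at the same $x$). $s(D;\mathcal F)$ is the number of orderings (permutations) of the functions $F_{q,a}$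 ($a\in D$) which occur for arbitrarily large $x$. $\mathcal B$ is a KT-system for $D$ if, with $\beta=R^-(\mathcal B)$, for every family $\mathcal F$ that is $\beta$-similar to $\mathcal P_q$ and all distinct $a,b\in D$, $F_{q,a}(x)>F_{q,b}(x)$ for arbitrarily large $x$. $\mathcal B$ is an extremal barrier for $D$ if it is a KT-system for $D$ and a barrier for the statement $s(D;\mathcal F)\ge \frac{|D|(|D|-1)}{2}+2$. *)

theory Defs
  imports
    "HOL-Analysis.Analysis"
    "HOL-Library.Landau_Symbols"
    "HOL-Number_Theory.Number_Theory"
    "HOL-Algebra.Elementary_Groups"
    "HOL-Combinatorics.Multiset_Permutations"
begin

text \<open>Reduced residues are represented by integers in \<open>{0..<q}\<close>, with multiplication modulo \<open>q\<close>.\<close>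

abbreviation reduced_residues :: "nat \<Rightarrow> int monoid" where
  "reduced_residues q \<equiv> units_of (residue_ring (int q))"

definition dirichlet_character :: "nat \<Rightarrow> (int \<Rightarrow> complex) \<Rightarrow> bool" where
  "dirichlet_character q \<psi> \<longleftrightarrow>
     (\<forall>m n. \<psi> (m * n) = \<psi> m * \<psi> n) \<and>
     (\<forall>m. \<psi> (m + int q) = \<psi> m) \<and>
     (\<forall>m. \<psi> m = 0 \<longleftrightarrow> \<not> coprime m (int q))"

definition principal_character :: "nat \<Rightarrow> int \<Rightarrow> complex" where
  "principal_character q = (\<lambda>m. if coprime m (int q) then 1 else 0)"

definition nonprincipal_characters :: "nat \<Rightarrow> (int \<Rightarrow> complex) set" where
  "nonprincipal_characters q = {\<psi>. dirichlet_character q \<psi> \<and> \<psi> \<noteq> principal_character q}"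

definition conj_character :: "(int \<Rightarrow> complex) \<Rightarrow> int \<Rightarrow> complex" where
  "conj_character \<psi> = (\<lambda>m. cnj (\<psi> m))"

text \<open>
  A possibly finite or empty sequence is a partial function on \<open>nat\<close> whose domain is an
  initial segment. The values of \<open>B\<close> outside the non-principal characters modulo \<open>q\<close> are
  irrelevant; all definitions below ignore them.
\<close>

type_synonym char_system = "(int \<Rightarrow> complex) \<Rightarrow> nat \<rightharpoonup> complex"

definition mult_in :: "char_system \<Rightarrow> complex \<Rightarrow> (int \<Rightarrow> complex) \<Rightarrow> nat" where
  "mult_in B \<rho> \<psi> = card {k. B \<psi> k = Some \<rho>}"

definition points :: "nat \<Rightarrow> char_system \<Rightarrow> complex set" where
  "points q B = (\<Union>\<psi>\<in>nonprincipal_characters q. ran (B \<psi>))"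

text \<open>In \<open>ereal\<close> the supremum and infimum over the empty set are \<open>-\<infinity>\<close> and \<open>\<infinity>\<close>.\<close>

definition R_plus :: "nat \<Rightarrow> char_system \<Rightarrow> ereal" where
  "R_plus q B = (SUP \<rho>\<in>points q B. ereal (Re \<rho>))"

definition R_minus :: "nat \<Rightarrow> char_system \<Rightarrow> ereal" where
  "R_minus q B = (INF \<rho>\<in>points q B. ereal (Re \<rho>))"

text \<open>
  Convergence of the double sum of \<open>mult_in B \<rho> \<psi> / \<bar>\<rho>\<bar>\<close> forces every multiplicity to be finite.
  This is stated separately because \<open>card\<close> is \<open>0\<close> on infinite sets.
\<close>

definition is_system :: "nat \<Rightarrow> char_system \<Rightarrow> bool" where
  "is_system q B \<longleftrightarrow>
     (\<forall>\<psi>\<in>nonprincipal_characters q.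
        (\<forall>i j. i \<le> j \<longrightarrow> j \<in> dom (B \<psi>) \<longrightarrow> i \<in> dom (B \<psi>)) \<and>
        (\<forall>\<rho>\<in>ran (B \<psi>). Im \<rho> \<ge> 0) \<and>
        (\<forall>\<rho>\<in>\<real>. mult_in B \<rho> \<psi> = mult_in B \<rho> (conj_character \<psi>)) \<and>
        (\<forall>\<rho>. finite {k. B \<psi> k = Some \<rho>}) \<and>
        (\<lambda>\<rho>. real (mult_in B \<rho> \<psi>) / norm \<rho>) summable_on ran (B \<psi>)) \<and>
     ereal (1/2) < R_minus q B \<and> R_minus q B \<le> R_plus q B \<and> R_plus q B \<le> 1"

definition finite_system :: "nat \<Rightarrow> char_system \<Rightarrow> bool" where
  "finite_system q B \<longleftrightarrow> (\<forall>\<psi>\<in>nonprincipal_characters q. finite (dom (B \<psi>)))"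

definition system_size :: "nat \<Rightarrow> char_system \<Rightarrow> nat" where
  "system_size q B = (\<Sum>\<psi>\<in>nonprincipal_characters q. card (dom (B \<psi>)))"

definition f_term :: "real \<Rightarrow> complex \<Rightarrow> complex" where
  "f_term x \<rho> = of_real x powr \<rho> / (\<rho> * of_real (ln x)) +
     1 / \<rho> * integral {2..x} (\<lambda>t. of_real t powr \<rho> / of_real (t * (ln t)\<^sup>2))"

definition weight :: "complex \<Rightarrow> real" where
  "weight \<rho> = (if \<rho> \<in> \<real> then 1/2 else 1)"

definition prime_pi :: "real \<Rightarrow> nat" where
  "prime_pi x = card {p::nat. prime p \<and> real p \<le> x}"

definition P_model :: "nat \<Rightarrow> char_system \<Rightarrow> int \<Rightarrow> real \<Rightarrow> real" where
  "P_model q B a x =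
     - (2 / real (totient q)) *
       Re (\<Sum>\<psi>\<in>nonprincipal_characters q. cnj (\<psi> a) *
            (\<Sum>\<^sub>\<infinity>\<rho>\<in>ran (B \<psi>). of_real (weight \<rho>) * of_nat (mult_in B \<rho> \<psi>) * f_term x \<rho>))
     + real (prime_pi x) / real (totient q)"

text \<open>
  Only the values of \<open>F a x\<close> for \<open>a\<close> a reduced residue and large \<open>x\<close> matter, so that families
  of functions on \<open>[0,\<infinity>)\<close> may be taken to be total functions.
\<close>

definition similar :: "real \<Rightarrow> nat \<Rightarrow> char_system \<Rightarrow> (int \<Rightarrow> real \<Rightarrow> real) \<Rightarrow> bool" where
  "similar \<beta> q B F \<longleftrightarrow>
     (\<forall>a\<in>carrier (reduced_residues q).
        (\<lambda>x. \<bar>F a x - P_model q B a x\<bar>) \<in> o[at_top](\<lambda>x. x powr \<beta> / ln x))"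

definition barrier ::
  "nat \<Rightarrow> char_system \<Rightarrow> ((int \<Rightarrow> real \<Rightarrow> real) \<Rightarrow> bool) \<Rightarrow> bool" where
  "barrier q B I \<longleftrightarrow> (\<forall>F. similar (real_of_ereal (R_minus q B)) q B F \<longrightarrow> \<not> I F)"

definition arbitrarily_large :: "(real \<Rightarrow> bool) \<Rightarrow> bool" where
  "arbitrarily_large A \<longleftrightarrow> \<not> bdd_above {x. 0 \<le> x \<and> A x}"

text \<open>An ordering is the list of the elements of \<open>D\<close> in the order in which they appear in the chain.\<close>

definition ordering_occurs :: "(int \<Rightarrow> real \<Rightarrow> real) \<Rightarrow> int list \<Rightarrow> real \<Rightarrow> bool" where
  "ordering_occurs F as x \<longleftrightarrow> successively (\<lambda>a b. F a x \<ge> F b x) as"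

definition num_orderings :: "int set \<Rightarrow> (int \<Rightarrow> real \<Rightarrow> real) \<Rightarrow> nat" where
  "num_orderings D F =
     card {as \<in> permutations_of_set D. arbitrarily_large (ordering_occurs F as)}"

definition KT_system :: "nat \<Rightarrow> int set \<Rightarrow> char_system \<Rightarrow> bool" where
  "KT_system q D B \<longleftrightarrow>
     (\<forall>F. similar (real_of_ereal (R_minus q B)) q B F \<longrightarrow>
        (\<forall>a\<in>D. \<forall>b\<in>D. a \<noteq> b \<longrightarrow> arbitrarily_large (\<lambda>x. F a x > F b x)))"

definition extremal_barrier :: "nat \<Rightarrow> int set \<Rightarrow> char_system \<Rightarrow> bool" where
  "extremal_barrier q D B \<longleftrightarrow>
     KT_system q D B \<and>
     barrier q B (\<lambda>F. real (num_orderings D F) \<ge> real (card D) * (real (card D) - 1) / 2 + 2)"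

end

theory Submission
  imports Defs "HOL-Real_Asymp.Real_Asymp"
begin

text \<open>
  All points of the barrier are \<open>\<rho>\<^sub>1 = \<beta> + \<i>\<gamma>\<close> and \<open>\<rho>\<^sub>2 = \<beta> + 2\<i>\<gamma>\<close> with \<open>\<beta> = 3/4\<close> and large \<open>\<gamma>\<close>.
  They are attached to the powers \<open>\<xi>, \<xi>\<^sup>2, \<dots>, \<xi>\<^bsup>r-1\<^esup>\<close> of one Dirichlet character \<open>\<xi>\<close> that is faithful on
  the cyclic group \<open>G\<close>. Divided by \<open>x\<^sup>\<beta> / ln x\<close> and by a positive constant, the difference of two
  functions in a \<open>\<beta>\<close>-similar family is, up to \<open>o(1)\<close>, the difference of two
  trigonometric polynomials of degree two in \<open>\<theta> = \<gamma> ln x\<close>. As \<open>1 / \<rho>\<^sub>k\<close> is close to \<open>- \<i> / (k \<gamma>)\<close>, everything depends on which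
  coefficients of \<open>e\<^sup>i\<^sup>\<theta>\<close> and of \<open>e\<^sup>2\<^sup>i\<^sup>\<theta>\<close> the multiplicities can produce.

  A function \<open>w\<close> on \<open>G\<close> has real Fourier coefficients exactly when \<open>w(a\<^sup>-\<^sup>1)\<close> is the conjugate of \<open>w(a)\<close>.
  Because \<open>D\<close> never contains both members of a pair \<open>a \<noteq> a\<^sup>-\<^sup>1\<close>, this leaves \<open>w\<close> free on \<open>D\<close>, except that
  it must be real at the element of order two. The sum of \<open>\<xi>(a)\<^sup>m\<close> over \<open>0 < m < r\<close> is \<open>-1\<close> for every
  \<open>a \<noteq> 1\<close> in \<open>G\<close>; as \<open>1 \<notin> D\<close>, adding a constant to all coefficients changes all values on \<open>D\<close> by the same amount,
  which no comparison sees. So the coefficients may be taken positive, and scaled by a large \<open>N\<close> they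
  can be replaced by integers (\<open>positive_integer_fourier_approximation\<close>).

  The polynomials are chosen so that \<open>a \<in> D\<close> runs along
  \<open>A t\<^sub>a sin \<theta> + t\<^sub>a\<^sup>2 cos 2\<theta>\<close>, where the numbers \<open>t\<^sub>a\<close> are distinct powers of two, with \<open>0\<close> at the
  element of order two, and \<open>A\<close> is large. The difference for \<open>a\<close> and \<open>b\<close> is
  \<open>(t\<^sub>a - t\<^sub>b) (A sin \<theta> + (t\<^sub>a + t\<^sub>b) cos 2\<theta>)\<close>. Where \<open>cos 2\<theta>\<close> is positive the second factor increases with the
  sum \<open>t\<^sub>a + t\<^sub>b\<close>; elsewhere \<open>\<bar>sin \<theta>\<bar>\<close> is large and the term \<open>A sin \<theta>\<close> decides the sign for all pairs at
  once. In both cases the pairs in inverted order are those with small sum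
  (\<open>crossing_factor_mono\<close>). Since different pairs have different sums, the set of inverted pairs is an
  initial segment of a chain of length \<open>|D| (|D| - 1) / 2\<close>, and it determines the ordering; thus at most
  \<open>|D| (|D| - 1) / 2 + 1\<close> orderings are possible (\<open>card_orderings_with_initial_inversions\<close>). At
  \<open>sin \<theta> = 1\<close> and \<open>sin \<theta> = -1\<close> each pair occurs in both orders, which makes the system a KT-system.

  By compactness of the range of \<open>sin \<theta>\<close> these statements survive a perturbation by some
  \<open>\<epsilon> > 0\<close> (\<open>orderings_robust\<close>), which absorbs the rounding to integers, the replacement of \<open>1 / \<rho>\<^sub>k\<close> and
  the \<open>o(1)\<close>. The scale \<open>N\<close>, and with it the number of points, depends on \<open>\<epsilon>\<close> alone, whereas \<open>\<gamma>\<close> may be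
  arbitrarily large: hence the barrier is bounded.
\<close>

section \<open>Counting orderings\<close>

text \<open>
  For distinct values of \<open>t\<close> the reference ordering is the one by decreasing \<open>t\<close>; an inversion is a pair
  that a list puts the other way round, written with the smaller \<open>t\<close> first.
\<close>

definition inversions :: "('a \<Rightarrow> 'b::linorder) \<Rightarrow> 'a list \<Rightarrow> ('a \<times> 'a) set" where
  "inversions t as = {(as ! i, as ! j) |i j. i < j \<and> j < length as \<and> t (as ! i) < t (as ! j)}"

lemma sorted_wrt_asym_unique:
  assumes "sorted_wrt R xs" "sorted_wrt R ys" "set xs = set ys" "distinct xs" "distinct ys"
    and asym: "\<And>x y. R x y \<Longrightarrow> \<not> R y x"
  shows "xs = ys"
  using assms(1-5)
proof (induction xs arbitrary: ys)
  case Nil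
  then show ?case by simp
next
  case (Cons x xs)
  then obtain y ys' where ys: "ys = y # ys'" by (cases ys) auto
  have "x = y"
  proof (rule ccontr)
    assume "x \<noteq> y"
    then have "x \<in> set ys'" "y \<in> set xs" using Cons.prems(3) ys by auto
    then have "R y x" "R x y" using Cons.prems(1,2) ys by auto
    then show False using asym by blast
  qed
  moreover have "set xs = set ys'"
    using Cons.prems(3-5) ys \<open>x = y\<close> by auto
  ultimately show ?case using Cons ys by auto
qed

text \<open>
  Given the inversions, the relative position of any two elements is known, so both lists are sorted
  with respect to the same asymmetric relation.
\<close>

lemma inversions_determine_ordering:
  assumes "distinct as" "distinct bs" "set as = set bs" "inj_on t (set as)"
    and "inversions t as = inversions t bs"
  shows "as = bs"
proof -
  define R where "R a b \<longleftrightarrow> (t a < t b \<and> (a, b) \<in> inversions t as)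
      \<or> (t b < t a \<and> (b, a) \<notin> inversions t as)" for a b
  have sorted: "sorted_wrt (\<lambda>a b. (t a < t b \<and> (a, b) \<in> inversions t cs)
      \<or> (t b < t a \<and> (b, a) \<notin> inversions t cs)) cs"
    if "distinct cs" "inj_on t (set cs)" for cs
    unfolding sorted_wrt_iff_nth_less
  proof (intro allI impI)
    fix i j assume ij: "i < j" "j < length cs"
    then have "cs ! i \<noteq> cs ! j" using that(1) by (simp add: nth_eq_iff_index_eq)
    then have "t (cs ! i) \<noteq> t (cs ! j)"
      using ij by (meson inj_onD nth_mem order.strict_trans that(2))
    moreover have "(cs ! j, cs ! i) \<notin> inversions t cs"
      using that(1) ij by (auto simp: inversions_def nth_eq_iff_index_eq)
    moreover have "t (cs ! i) < t (cs ! j) \<Longrightarrow> (cs ! i, cs ! j) \<in> inversions t cs"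
      using ij by (auto simp: inversions_def)
    ultimately show "(t (cs ! i) < t (cs ! j) \<and> (cs ! i, cs ! j) \<in> inversions t cs)
      \<or> (t (cs ! j) < t (cs ! i) \<and> (cs ! j, cs ! i) \<notin> inversions t cs)"
      by (meson linorder_neqE)
  qed
  have "sorted_wrt R as" "sorted_wrt R bs"
    using sorted[of as] sorted[of bs] assms unfolding R_def by auto
  then show ?thesis
    by (rule sorted_wrt_asym_unique) (use assms in \<open>auto simp: R_def\<close>)
qed

lemma card_increasing_pairs:
  assumes "finite D" "inj_on t D"
  shows "2 * card {(a, b). a \<in> D \<and> b \<in> D \<and> t a < (t b :: 'b::linorder)} = card D * (card D - 1)"
proof -
  define Q where "Q = {(a, b). a \<in> D \<and> b \<in> D \<and> t a < t b}"
  have fin: "finite Q"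
    by (rule finite_subset[of _ "D \<times> D"]) (use assms in \<open>auto simp: Q_def\<close>)
  have "D \<times> D = Q \<union> prod.swap ` Q \<union> (\<lambda>a. (a, a)) ` D"
    using assms(2) unfolding Q_def
    by (auto simp: image_iff inj_on_def dest: linorder_neqE)
  also have "card \<dots> = card (Q \<union> prod.swap ` Q) + card ((\<lambda>a. (a, a)) ` D)"
    using fin assms by (intro card_Un_disjoint) (auto simp: Q_def)
  also have "card (Q \<union> prod.swap ` Q) = card Q + card (prod.swap ` Q)"
    using fin by (intro card_Un_disjoint) (auto simp: Q_def)
  also have "card (prod.swap ` Q) = card Q"
    by (intro card_image inj_onI) auto
  also have "card ((\<lambda>a. (a, a)) ` D) = card D"
    by (intro card_image inj_onI) auto
  finally have "card D * card D = 2 * card Q + card D"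
    by (simp add: card_cartesian_product)
  then show ?thesis unfolding Q_def[symmetric] by (simp add: diff_mult_distrib2)
qed

text \<open>
  The hypotheses say that \<open>(a, b) \<mapsto> t a + t b\<close> is injective on increasing pairs and that each inversion set is
  downward closed for it. Downward closed subsets of a chain are comparable, so the inversion set, and hence
  the ordering, is determined by the number of inversions.
\<close>

lemma card_orderings_with_initial_inversions:
  fixes t :: "'a \<Rightarrow> nat"
  assumes fin: "finite D" and inj: "inj_on t D"
    and sums: "\<And>a b c d. \<lbrakk>a \<in> D; b \<in> D; c \<in> D; d \<in> D; t a < t b; t c < t d;
                 t a + t b = t c + t d\<rbrakk> \<Longrightarrow> a = c \<and> b = d"
    and P: "P \<subseteq> permutations_of_set D"
    and down: "\<And>as a b c d. \<lbrakk>as \<in> P; (a, b) \<in> inversions t as; c \<in> D; d \<in> D; t c < t d;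
                 t c + t d < t a + t b\<rbrakk> \<Longrightarrow> (c, d) \<in> inversions t as"
  shows "2 * card P \<le> card D * (card D - 1) + 2"
proof -
  define Q where "Q = {(a, b). a \<in> D \<and> b \<in> D \<and> t a < t b}"
  have finQ: "finite Q"
    by (rule finite_subset[of _ "D \<times> D"]) (use fin in \<open>auto simp: Q_def\<close>)
  have sub: "inversions t as \<subseteq> Q" if "as \<in> P" for as
    using that P by (auto simp: inversions_def Q_def permutations_of_set_def)
  have "inj_on (\<lambda>as. card (inversions t as)) P"
  proof (rule inj_onI)
    fix as bs assume as: "as \<in> P" and bs: "bs \<in> P"
      and eq: "card (inversions t as) = card (inversions t bs)"
    have "inversions t as \<subseteq> inversions t bs \<or> inversions t bs \<subseteq> inversions t as"
    proof (rule ccontr)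
      assume "\<not> ?thesis"
      then obtain a b c d where ab: "(a, b) \<in> inversions t as" "(a, b) \<notin> inversions t bs"
        and cd: "(c, d) \<in> inversions t bs" "(c, d) \<notin> inversions t as"
        by (metis subsetI surj_pair)
      have mem: "(a, b) \<in> Q" "(c, d) \<in> Q" using sub as bs ab cd by auto
      have "\<not> t c + t d < t a + t b" using down[OF as ab(1), of c d] cd(2) mem by (auto simp: Q_def)
      moreover have "\<not> t a + t b < t c + t d"
        using down[OF bs cd(1), of a b] ab(2) mem by (auto simp: Q_def)
      ultimately have "a = c \<and> b = d" using mem by (intro sums) (auto simp: Q_def)
      then show False using ab cd by simp
    qed
    then have "inversions t as = inversions t bs"
      using eq card_subset_eq sub as bs finite_subset[OF _ finQ] by metis
    then show "as = bs"
      using as bs P inj by (intro inversions_determine_ordering) (auto simp: permutations_of_set_def)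
  qed
  then have "card P = card ((\<lambda>as. card (inversions t as)) ` P)"
    by (simp add: card_image)
  also have "\<dots> \<le> card {..card Q}"
    by (intro card_mono) (auto intro!: card_mono finQ sub)
  finally have "card P \<le> card Q + 1" by simp
  then show ?thesis using card_increasing_pairs[OF fin inj] unfolding Q_def by linarith
qed

section \<open>Stability of the set of orderings\<close>

text \<open>
  The sum of the positive parts of the \<open>h i\<close> is continuous and positive, hence bounded away from \<open>0\<close>; some
  summand is then at least of average size.
\<close>

lemma compact_uniformly_positive:
  fixes h :: "'i \<Rightarrow> 'a::topological_space \<Rightarrow> real"
  assumes "compact S" "finite I" and cont: "\<And>i. i \<in> I \<Longrightarrow> continuous_on S (h i)"
    and pos: "\<And>y. y \<in> S \<Longrightarrow> \<exists>i\<in>I. h i y > 0"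
  shows "\<exists>\<delta>>0. \<forall>y\<in>S. \<exists>i\<in>I. h i y > \<delta>"
proof (cases "S = {}")
  case True
  then show ?thesis by (intro exI[of _ 1]) auto
next
  case False
  define H where "H y = (\<Sum>i\<in>I. max 0 (h i y))" for y
  have "continuous_on S H"
    unfolding H_def by (intro continuous_intros cont)
  then obtain y0 where y0: "y0 \<in> S" "\<And>y. y \<in> S \<Longrightarrow> H y0 \<le> H y"
    using continuous_attains_inf[OF assms(1) False] by metis
  obtain i0 where i0: "i0 \<in> I" "h i0 y0 > 0" using pos[OF y0(1)] by auto
  have "0 < max 0 (h i0 y0)" using i0 by simp
  also have "\<dots> \<le> H y0"
    unfolding H_def using i0 assms(2) by (intro member_le_sum) auto
  finally have H0: "0 < H y0" .
  define \<delta> where "\<delta> = H y0 / (2 * real (card I))"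
  have cI: "card I > 0" using i0 assms(2) by (auto simp: card_gt_0_iff)
  have "\<exists>i\<in>I. h i y > \<delta>" if "y \<in> S" for y
  proof (rule ccontr)
    assume "\<not> ?thesis"
    then have "H y \<le> (\<Sum>i\<in>I. \<delta>)"
      unfolding H_def using H0 cI by (intro sum_mono) (auto simp: \<delta>_def not_less)
    also have "\<dots> = H y0 / 2" using cI by (simp add: \<delta>_def)
    finally show False using y0(2)[OF that] H0 by simp
  qed
  moreover have "\<delta> > 0" using H0 cI by (simp add: \<delta>_def)
  ultimately show ?thesis by blast
qed

text \<open>
  An ordering that is violated at every \<open>y\<close> in the compact set \<open>S\<close> is violated by a uniform margin, because
  each violation is a positive difference of neighbouring values. There are only finitely many orderings.
\<close>

lemma orderings_robust:
  fixes V :: "'b::topological_space \<Rightarrow> 'a \<Rightarrow> real"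
  assumes "finite D" "compact S" and cont: "\<And>a. a \<in> D \<Longrightarrow> continuous_on S (\<lambda>y. V y a)"
  shows "\<forall>\<^sub>F \<epsilon> in at_right 0. \<forall>as\<in>permutations_of_set D. \<forall>y\<in>S.
           successively (\<lambda>a b. V y b \<le> V y a + \<epsilon>) as \<longrightarrow>
           (\<exists>y\<in>S. successively (\<lambda>a b. V y b \<le> V y a) as)"
proof (rule eventually_ball_finite; safe?)
  show "finite (permutations_of_set D)" using assms by simp
next
  fix as assume as: "as \<in> permutations_of_set D"
  show "\<forall>\<^sub>F \<epsilon> in at_right 0. \<forall>y\<in>S.
           successively (\<lambda>a b. V y b \<le> V y a + \<epsilon>) as \<longrightarrow>
           (\<exists>y\<in>S. successively (\<lambda>a b. V y b \<le> V y a) as)"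
  proof (cases "\<exists>y\<in>S. successively (\<lambda>a b. V y b \<le> V y a) as")
    case True
    then show ?thesis by simp
  next
    case False
    define h where "h i y = V y (as ! Suc i) - V y (as ! i)" for i y
    have "\<exists>\<delta>>0. \<forall>y\<in>S. \<exists>i\<in>{i. Suc i < length as}. h i y > \<delta>"
    proof (rule compact_uniformly_positive)
      show "finite {i. Suc i < length as}" by (rule finite_subset[of _ "{..length as}"]) auto
      show "continuous_on S (h i)" if "i \<in> {i. Suc i < length as}" for i
        using that as unfolding h_def
        by (intro continuous_intros cont) (auto simp: permutations_of_set_def)
      show "\<exists>i\<in>{i. Suc i < length as}. h i y > 0" if "y \<in> S" for y
        using False that unfolding successively_conv_nth h_def by force
    qed (use assms in auto)
    then obtain \<delta> where \<delta>: "\<delta> > 0" "\<And>y. y \<in> S \<Longrightarrow> \<exists>i. Suc i < length as \<and> h i y > \<delta>"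
      by auto
    have "\<forall>\<^sub>F \<epsilon> in at_right 0. \<epsilon> < \<delta>"
      using \<delta>(1) by (auto simp: eventually_at_right_field)
    then show ?thesis
      by eventually_elim (use \<delta>(2) in \<open>fastforce simp: successively_conv_nth h_def\<close>)
  qed
qed

section \<open>The model race\<close>

text \<open>
  With \<open>y = sin \<theta>\<close> this is \<open>A t\<^sub>a sin \<theta> + t\<^sub>a\<^sup>2 cos 2\<theta>\<close>. The variable \<open>y\<close> in place of \<open>\<theta>\<close> makes the
  parameter range the interval \<open>[-1, 1]\<close>.
\<close>

definition race :: "real \<Rightarrow> ('a \<Rightarrow> nat) \<Rightarrow> real \<Rightarrow> 'a \<Rightarrow> real" where
  "race A t y a = A * real (t a) * y + (real (t a))\<^sup>2 * (1 - 2 * y\<^sup>2)"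

lemma race_diff:
  "race A t y a - race A t y b =
    (real (t a) - real (t b)) * (A * y + (real (t a) + real (t b)) * (1 - 2 * y\<^sup>2))"
  by (simp add: race_def algebra_simps power2_eq_square)

text \<open>
  The set of sums \<open>s\<close> for which the second factor in \<open>race_diff\<close> is non-positive is downward closed. If
  \<open>1 - 2 y\<^sup>2 > 0\<close> the factor increases with \<open>s\<close>. Otherwise \<open>0 \<le> 2 y\<^sup>2 - 1 \<le> \<bar>y\<bar>\<close>, so \<open>s < A\<close> gives the
  factor the sign of \<open>y\<close> for every admissible \<open>s\<close>.
\<close>

lemma crossing_factor_mono:
  fixes A y s s' :: real
  assumes "\<bar>y\<bar> \<le> 1" "0 \<le> s'" "s' < s" "s < A" "A * y + s * (1 - 2 * y\<^sup>2) \<le> 0"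
  shows "A * y + s' * (1 - 2 * y\<^sup>2) < 0"
proof (cases "0 < 1 - 2 * y\<^sup>2")
  case True
  then have "s' * (1 - 2 * y\<^sup>2) < s * (1 - 2 * y\<^sup>2)" using assms by simp
  then show ?thesis using assms by linarith
next
  case False
  have y2: "y\<^sup>2 \<le> \<bar>y\<bar>" using assms(1) by (metis abs_ge_zero abs_le_square_iff abs_one mult_left_le power2_abs power2_eq_square)
  have y0: "y \<noteq> 0" using False by auto
  have "2 * y\<^sup>2 - 1 \<le> \<bar>y\<bar>"
    using y2 abs_square_le_1[of y] assms(1) by linarith
  then have bound: "u * (2 * y\<^sup>2 - 1) < A * \<bar>y\<bar>" if "0 \<le> u" "u < A" for u
  proof -
    have "u * (2 * y\<^sup>2 - 1) \<le> u * \<bar>y\<bar>"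
      using \<open>2 * y\<^sup>2 - 1 \<le> \<bar>y\<bar>\<close> that(1) by (rule mult_left_mono)
    also have "\<dots> < A * \<bar>y\<bar>"
      using that(2) y0 by (intro mult_strict_right_mono) auto
    finally show ?thesis .
  qed
  show ?thesis
  proof (cases "y > 0")
    case True
    then show ?thesis using bound[of s] assms by (simp add: algebra_simps)
  next
    case neg: False
    have "s' * (1 - 2 * y\<^sup>2) \<le> 0" using assms False by (simp add: mult_nonneg_nonpos)
    moreover have "A * y < 0" using assms neg y0 by (intro mult_pos_neg) auto
    ultimately show ?thesis by linarith
  qed
qed

text \<open>
  If the values at least double from each one to the next, the larger summand can be read off from
  the sum: \<open>t b \<le> t a + t b < 2 * t b\<close>.
\<close>

lemma superincreasing_sums:
  fixes t :: "'a \<Rightarrow> nat"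
  assumes inj: "inj_on t D" and super: "\<And>a b. \<lbrakk>a \<in> D; b \<in> D; t a < t b\<rbrakk> \<Longrightarrow> 2 * t a \<le> t b"
    and D: "a \<in> D" "b \<in> D" "c \<in> D" "d \<in> D" and "t a < t b" "t c < t d" "t a + t b = t c + t d"
  shows "a = c \<and> b = d"
proof -
  have "t b = t d"
    using super[of b d] super[of d b] assms(4-9) by linarith
  moreover from this have "t a = t c" using assms(9) by simp
  ultimately show ?thesis using inj D by (auto dest: inj_onD)
qed

lemma race_orderings_card:
  fixes t :: "'a \<Rightarrow> nat"
  assumes fin: "finite D" and inj: "inj_on t D"
    and super: "\<And>a b. \<lbrakk>a \<in> D; b \<in> D; t a < t b\<rbrakk> \<Longrightarrow> 2 * t a \<le> t b"
    and A: "\<And>a b. \<lbrakk>a \<in> D; b \<in> D\<rbrakk> \<Longrightarrow> real (t a) + real (t b) < A"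
  shows "2 * card {as \<in> permutations_of_set D. \<exists>y\<in>{-1..1}.
            successively (\<lambda>a b. race A t y b \<le> race A t y a) as} \<le> card D * (card D - 1) + 2"
proof (rule card_orderings_with_initial_inversions[OF fin inj superincreasing_sums[OF inj super]])
  fix as a b c d
  assume as: "as \<in> {as \<in> permutations_of_set D. \<exists>y\<in>{-1..1}.
            successively (\<lambda>a b. race A t y b \<le> race A t y a) as}"
    and ab: "(a, b) \<in> inversions t as" and cd: "c \<in> D" "d \<in> D" "t c < t d"
    and less: "t c + t d < t a + t b"
  obtain y where y: "\<bar>y\<bar> \<le> 1" and "successively (\<lambda>a b. race A t y b \<le> race A t y a) as"
    using as by (auto simp: abs_le_iff)
  then have sorted: "sorted_wrt (\<lambda>a b. race A t y b \<le> race A t y a) as"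
    by (subst (asm) successively_conv_sorted_wrt) (auto simp: transp_def)
  have set: "set as = D" and dist: "distinct as"
    using as by (auto simp: permutations_of_set_def)
  obtain i j where ij: "i < j" "j < length as" "as ! i = a" "as ! j = b" "t a < t b"
    using ab by (auto simp: inversions_def)
  have D: "a \<in> D" "b \<in> D" using ij set by force+
  have "0 \<le> race A t y a - race A t y b"
    using sorted ij by (auto simp: sorted_wrt_iff_nth_less)
  \<comment> \<open>The pair is inverted at \<open>y\<close>: its factor is not positive. Then the factor of every pair with a
      smaller sum is negative.\<close>
  then have "A * y + (real (t a) + real (t b)) * (1 - 2 * y\<^sup>2) \<le> 0"
    using ij(5) unfolding race_diff by (simp add: zero_le_mult_iff)
  then have "A * y + (real (t c) + real (t d)) * (1 - 2 * y\<^sup>2) < 0"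
    using y less A[OF D] by (intro crossing_factor_mono[where s = "real (t a) + real (t b)"]) linarith+
  then have "0 < (real (t c) - real (t d)) * (A * y + (real (t c) + real (t d)) * (1 - 2 * y\<^sup>2))"
    using cd(3) by (intro mult_neg_neg) auto
  then have gt: "race A t y d < race A t y c"
    using race_diff[of A t y c d] by linarith
  obtain k l where kl: "k < length as" "l < length as" "as ! k = c" "as ! l = d"
    using cd set by (metis in_set_conv_nth)
  have "k \<noteq> l" using kl gt by auto
  moreover have "\<not> l < k"
    using sorted kl gt by (auto simp: sorted_wrt_iff_nth_less not_le[symmetric])
  ultimately show "(c, d) \<in> inversions t as"
    unfolding inversions_def using kl cd(3) by (metis (mono_tags, lifting) CollectI linorder_neqE_nat)
qed auto

text \<open>
  At \<open>y = 1\<close> the larger \<open>t\<close> leads and at \<open>y = -1\<close> the smaller one, each time by at least \<open>1\<close> since \<open>t\<close> takes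
  integer values.
\<close>

lemma race_wins:
  fixes t :: "'a \<Rightarrow> nat"
  assumes "t a \<noteq> t b" and A: "real (t a) + real (t b) + 1 \<le> A"
  shows "1 \<le> race A t (if t b < t a then 1 else -1) a - race A t (if t b < t a then 1 else -1) b"
proof (cases "t b < t a")
  case True
  have "1 * 1 \<le> (real (t a) - real (t b)) * (A - (real (t a) + real (t b)))"
    by (rule mult_mono) (use True A in auto)
  also have "\<dots> = race A t 1 a - race A t 1 b" by (simp add: race_diff algebra_simps)
  finally show ?thesis using True by simp
next
  case False
  have "1 * 1 \<le> (real (t b) - real (t a)) * (A + (real (t a) + real (t b)))"
    by (rule mult_mono) (use False A assms(1) in auto)
  also have "\<dots> = race A t (-1) a - race A t (-1) b" by (simp add: race_diff algebra_simps)
  finally show ?thesis using False by simp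
qed

section \<open>Roots of unity\<close>

lemma sum_powers_root_of_unity:
  fixes z :: complex
  assumes "z ^ n = 1"
  shows "(\<Sum>i<n. z ^ i) = (if z = 1 then of_nat n else 0)"
  using assms by (simp add: geometric_sum)

lemma sum_lessThan_shift_cyclic:
  fixes h :: "nat \<Rightarrow> 'a::ab_group_add"
  assumes "h n = h 0"
  shows "(\<Sum>i<n. h (Suc i)) = (\<Sum>i<n. h i)"
  using sum.lessThan_Suc_shift[of h n] sum.lessThan_Suc[of h n] assms by (simp add: add.commute)

lemma norm_root_of_unity:
  fixes z :: complex
  assumes "z ^ n = 1" "n > 0"
  shows "norm z = 1"
proof (rule power_eq_imp_eq_base)
  show "norm z ^ n = 1 ^ n" using assms by (simp flip: norm_power)
qed (use assms in auto)

lemma root_of_unity_times_cnj: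
  fixes z :: complex
  assumes "z ^ n = 1" "n > 0"
  shows "z * cnj z = 1"
  using norm_root_of_unity[OF assms] by (simp add: complex_norm_square[symmetric])

lemma cis_primitive_root:
  assumes "0 < i" "i < n"
  shows "cis (2 * pi / real n) ^ i \<noteq> 1"
proof
  assume "cis (2 * pi / real n) ^ i = 1"
  then have "cos (2 * pi * (real i / real n)) = 1"
    unfolding Complex.DeMoivre by (simp add: complex_eq_iff mult_ac)
  then obtain k :: int where "2 * pi * (real i / real n) = of_int k * 2 * pi"
    by (auto simp: cos_one_2pi_int)
  then have "2 * pi * real i = 2 * pi * (of_int k * real n)" using assms by (simp add: field_simps)
  then have "real i = of_int k * real n" by simp
  then have "int i = k * int n" by (metis of_int_eq_iff of_int_mult of_int_of_nat_eq)
  then have "int n dvd int i" by simp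
  then show False using assms by (simp add: nat_dvd_not_less)
qed

text \<open>
  Fourier inversion on the group of \<open>r\<close>-th roots of unity. The function \<open>\<phi>\<close> on \<open>Z\<close> is extended to the conjugates
  of the elements of \<open>Z\<close> so that conjugate arguments have conjugate values, and by \<open>0\<close> elsewhere; its Fourier
  coefficients are then real. The hypotheses on \<open>Z\<close> say that this extension is well defined. On non-trivial roots of
  unity, dropping the term \<open>m = 0\<close> and adding a large constant to all other coefficients shift the
  values by a constant, which is collected in \<open>C\<close>.
\<close>

lemma nonneg_fourier_expansion:
  fixes Z :: "complex set" and \<phi> :: "complex \<Rightarrow> complex"
  assumes r: "r > 0" and root: "\<And>z. z \<in> Z \<Longrightarrow> z ^ r = 1 \<and> z \<noteq> 1"
    and noconj: "\<And>z. \<lbrakk>z \<in> Z; cnj z \<noteq> z\<rbrakk> \<Longrightarrow> cnj z \<notin> Z"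
    and real: "\<And>z. \<lbrakk>z \<in> Z; cnj z = z\<rbrakk> \<Longrightarrow> \<phi> z \<in> \<real>"
  shows "\<exists>c C. (\<forall>m. 0 \<le> (c m :: real)) \<and>
           (\<forall>z\<in>Z. (\<Sum>m=1..<r. of_real (c m) * z ^ m) = \<phi> z + C)"
proof -
  have finZ: "finite Z"
    by (rule finite_subset[OF _ finite_roots_unity[of r]]) (use r root in auto)
  have unit: "z * cnj z = 1" if "z \<in> Z" for z
    using root[OF that] r by (intro root_of_unity_times_cnj) auto
  have root': "cnj z ^ r = 1" if "z \<in> Z" for z
    using root[OF that] by (metis complex_cnj_one complex_cnj_power)
  \<comment> \<open>A real \<open>y\<close> is its own conjugate and would be counted twice in the extension.\<close>
  define \<kappa> where "\<kappa> y = (if cnj y = y then 1 / 2 else 1 :: complex)" for y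
  define e where "e m = (\<Sum>y\<in>Z. \<kappa> y * (\<phi> y * cnj y ^ m + cnj (\<phi> y) * y ^ m))" for m :: nat
  define d where "d m = e m / of_nat r" for m
  have "cnj (d m) = d m" for m
    unfolding d_def e_def complex_cnj_divide cnj_sum complex_cnj_of_nat
    by (intro arg_cong2[where f="(/)"] sum.cong refl) (auto simp: \<kappa>_def add.commute)
  then have d: "of_real (Re (d m)) = d m" for m
    by (metis Reals_cnj_iff of_real_Re)
  have inversion: "(\<Sum>m<r. d m * z ^ m) = \<phi> z" if z: "z \<in> Z" for z
  proof -
    have eq: "(\<Sum>m<r. cnj y ^ m * z ^ m) = (if y = z then of_nat r else 0)"
             "(\<Sum>m<r. y ^ m * z ^ m) = (if y = cnj z then of_nat r else 0)" if y: "y \<in> Z" for y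
    proof -
      have "cnj y * z = 1 \<longleftrightarrow> y = z" "y * z = 1 \<longleftrightarrow> y = cnj z"
        using unit[OF y] unit[OF z] by (metis mult.commute mult.left_commute mult.right_neutral)+
      moreover have "(cnj y * z) ^ r = 1" "(y * z) ^ r = 1"
        using root' root y z by (auto simp: power_mult_distrib)
      ultimately show "(\<Sum>m<r. cnj y ^ m * z ^ m) = (if y = z then of_nat r else 0)"
             "(\<Sum>m<r. y ^ m * z ^ m) = (if y = cnj z then of_nat r else 0)"
        by (simp_all add: sum_powers_root_of_unity flip: power_mult_distrib)
    qed
    have "of_nat r * (\<Sum>m<r. d m * z ^ m) = (\<Sum>m<r. e m * z ^ m)"
      using r by (simp add: d_def sum_distrib_left)
    also have "\<dots> =
        (\<Sum>m<r. \<Sum>y\<in>Z. \<kappa> y * (\<phi> y * (cnj y ^ m * z ^ m) + cnj (\<phi> y) * (y ^ m * z ^ m)))"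
      by (simp add: e_def sum_distrib_right ring_distribs mult.assoc)
    also have "\<dots> = (\<Sum>y\<in>Z. \<kappa> y * (\<phi> y * (\<Sum>m<r. cnj y ^ m * z ^ m) + cnj (\<phi> y) * (\<Sum>m<r. y ^ m * z ^ m)))"
      by (subst sum.swap) (simp add: sum_distrib_left distrib_left sum.distrib)
    also have "\<dots> = (\<Sum>y\<in>Z. (if y = z then \<kappa> y * \<phi> y * of_nat r else 0)
                      + (if y = cnj z then \<kappa> y * cnj (\<phi> y) * of_nat r else 0))"
      by (intro sum.cong refl) (simp add: eq distrib_left)
    also have "\<dots> = of_nat r * \<phi> z"
    proof (cases "cnj z = z")
      case True
      then show ?thesis using z finZ real[OF z True]
        by (simp add: sum.distrib \<kappa>_def Reals_cnj_iff)
    next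
      case False
      then show ?thesis using z finZ noconj[OF z False]
        by (simp add: sum.distrib \<kappa>_def)
    qed
    finally show ?thesis using r by simp
  qed
  define M where "M = (\<Sum>m<r. \<bar>Re (d m)\<bar>)"
  define c where "c m = (if m < r then Re (d m) + M else 0)" for m
  have "0 \<le> c m" for m
  proof (cases "m < r")
    case True
    then have "\<bar>Re (d m)\<bar> \<le> M" unfolding M_def by (intro member_le_sum) auto
    then have "0 \<le> Re (d m) + M" by linarith
    then show ?thesis by (simp add: c_def)
  qed (simp add: c_def)
  moreover have "(\<Sum>m=1..<r. of_real (c m) * z ^ m) = \<phi> z + (- d 0 - of_real M)" if z: "z \<in> Z" for z
  proof -
    have "(\<Sum>m=1..<r. of_real (c m) * z ^ m) = (\<Sum>m=1..<r. d m * z ^ m + of_real M * z ^ m)"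
      by (intro sum.cong) (auto simp: c_def d algebra_simps)
    also have "\<dots> = (\<Sum>m<r. d m * z ^ m + of_real M * z ^ m) - (d 0 + of_real M)"
      using r by (simp add: lessThan_atLeast0 sum.atLeast_Suc_lessThan)
    also have "(\<Sum>m<r. d m * z ^ m + of_real M * z ^ m) = \<phi> z + of_real M * (\<Sum>m<r. z ^ m)"
      using inversion[OF z] by (simp add: sum.distrib sum_distrib_left)
    finally show ?thesis
      using root[OF z] by (simp add: sum_powers_root_of_unity)
  qed
  ultimately show ?thesis by blast
qed

text \<open>
  Rounding the coefficients of the expansion up to multiples of \<open>1 / N\<close> costs at most \<open>1 / N\<close> for each of the
  fewer than \<open>r\<close> terms. The constant \<open>C\<close> does not depend on \<open>N\<close> or on the point. Strictly positive integers
  ensure later that the system has points even if \<open>D\<close> is empty.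
\<close>

lemma positive_integer_fourier_approximation:
  fixes \<zeta> \<phi> :: "'i \<Rightarrow> complex"
  assumes r: "r > 0" and root: "\<And>a. a \<in> D \<Longrightarrow> \<zeta> a ^ r = 1 \<and> \<zeta> a \<noteq> 1"
    and inj: "\<And>a b. \<lbrakk>a \<in> D; b \<in> D; \<zeta> b = \<zeta> a \<or> \<zeta> b = cnj (\<zeta> a)\<rbrakk> \<Longrightarrow> a = b"
    and real: "\<And>a. \<lbrakk>a \<in> D; cnj (\<zeta> a) = \<zeta> a\<rbrakk> \<Longrightarrow> \<phi> a \<in> \<real>"
  shows "\<exists>C. \<forall>N>0. \<exists>n. (\<forall>m. 0 < (n m :: nat)) \<and>
           (\<forall>a\<in>D. norm ((\<Sum>m=1..<r. of_nat (n m) * \<zeta> a ^ m) / of_nat N - (\<phi> a + C)) \<le> real r / real N)"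
proof -
  have "inj_on \<zeta> D" using inj by (intro inj_onI) metis
  then have inv: "inv_into D \<zeta> (\<zeta> a) = a" if "a \<in> D" for a using that by (rule inv_into_f_f)
  have "\<exists>c C. (\<forall>m. 0 \<le> (c m :: real)) \<and>
           (\<forall>z\<in>\<zeta> ` D. (\<Sum>m=1..<r. of_real (c m) * z ^ m) = (\<phi> \<circ> inv_into D \<zeta>) z + C)"
  proof (rule nonneg_fourier_expansion[OF r])
    show "z ^ r = 1 \<and> z \<noteq> 1" if "z \<in> \<zeta> ` D" for z using that root by auto
    show "cnj z \<notin> \<zeta> ` D" if z: "z \<in> \<zeta> ` D" "cnj z \<noteq> z" for z
    proof
      assume "cnj z \<in> \<zeta> ` D"
      then obtain a b where "a \<in> D" "b \<in> D" "z = \<zeta> a" "cnj z = \<zeta> b" using z by blast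
      then show False using inj[of a b] z(2) by simp
    qed
    show "(\<phi> \<circ> inv_into D \<zeta>) z \<in> \<real>" if "z \<in> \<zeta> ` D" "cnj z = z" for z
      using that real inv by auto
  qed
  then obtain c C where "\<forall>m. 0 \<le> (c m :: real)"
    "\<forall>z\<in>\<zeta> ` D. (\<Sum>m=1..<r. of_real (c m) * z ^ m) = (\<phi> \<circ> inv_into D \<zeta>) z + C"
    by (elim exE conjE)
  then have c: "\<And>m. 0 \<le> c m"
    and C: "\<And>a. a \<in> D \<Longrightarrow> (\<Sum>m=1..<r. of_real (c m) * \<zeta> a ^ m) = \<phi> a + C"
    using inv by simp_all
  show ?thesis
  proof (intro exI[of _ C] allI impI)
    fix N :: nat assume N: "N > 0"
    define n where "n m = Suc (nat \<lfloor>real N * c m\<rfloor>)" for m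
    have close: "\<bar>real (n m) / real N - c m\<bar> \<le> 1 / real N" for m
    proof -
      have "0 \<le> real N * c m" using c by simp
      then have "\<bar>real (n m) - real N * c m\<bar> \<le> 1" unfolding n_def by linarith
      moreover have "real (n m) / real N - c m = (real (n m) - real N * c m) / real N"
        using N by (simp add: diff_divide_distrib)
      ultimately show ?thesis by (simp add: divide_right_mono)
    qed
    have "norm ((\<Sum>m=1..<r. of_nat (n m) * \<zeta> a ^ m) / of_nat N - (\<phi> a + C)) \<le> real r / real N"
      if a: "a \<in> D" for a
    proof -
      have "norm (\<zeta> a) = 1"
        using root[OF a] r by (intro norm_root_of_unity[of "\<zeta> a" r]) auto
      then have "norm ((\<Sum>m=1..<r. of_nat (n m) * \<zeta> a ^ m) / of_nat N - (\<phi> a + C))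
          = norm (\<Sum>m=1..<r. of_real (real (n m) / real N - c m) * \<zeta> a ^ m)"
        unfolding C[OF a, symmetric]
        by (simp add: sum_divide_distrib sum_subtractf algebra_simps)
      also have "\<dots> \<le> (\<Sum>m=1..<r. 1 / real N)"
        using close \<open>norm (\<zeta> a) = 1\<close> by (intro sum_norm_le) (simp add: norm_mult norm_power del: of_real_diff)
      also have "\<dots> \<le> real r / real N" by (simp add: divide_right_mono)
      finally show ?thesis .
    qed
    then show "\<exists>n. (\<forall>m. 0 < n m) \<and>
           (\<forall>a\<in>D. norm ((\<Sum>m=1..<r. of_nat (n m) * \<zeta> a ^ m) / of_nat N - (\<phi> a + C)) \<le> real r / real N)"
      by (intro exI[of _ n]) (auto simp: n_def)
  qed
qed

section \<open>Dirichlet characters\<close>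

lemma periodic_cong:
  fixes f :: "int \<Rightarrow> 'a"
  assumes per: "\<And>m. f (m + q) = f m" and "[m = n] (mod q)"
  shows "f m = f n"
proof -
  have nat: "f (m + int k * q) = f m" for m k
  proof (induction k)
    case (Suc k)
    then show ?case using per[of "m + int k * q"] by (simp add: algebra_simps)
  qed simp
  have int: "f (m + k * q) = f m" for m k
  proof (cases "k \<ge> 0")
    case True
    then show ?thesis using nat[of m "nat k"] by simp
  next
    case False
    then show ?thesis using nat[of "m + k * q" "nat (- k)"] by (simp add: algebra_simps)
  qed
  obtain k where "n = m + k * q"
    using assms(2) by (metis cong_iff_lin mult.commute)
  then show ?thesis using int by simp
qed

lemma int_euler_theorem:
  assumes "coprime a (int q)"
  shows "[a ^ totient q = 1] (mod int q)"
proof (cases "q = 0")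
  case False
  then have "coprime (int (nat (a mod int q))) (int q)"
    using assms by simp
  then have "coprime (nat (a mod int q)) q" by (simp only: coprime_int_iff)
  then have "[nat (a mod int q) ^ totient q = 1] (mod q)" by (rule euler_theorem)
  then have "[int (nat (a mod int q) ^ totient q) = int 1] (mod int q)" by (simp only: cong_int_iff)
  then show ?thesis using False by (simp add: cong_def power_mod)
qed (use assms in auto)

text \<open>
  Summing over the powers of \<open>x\<close>, twisted by \<open>z\<close>, is up to a factor \<open>n\<close> the projection onto the functions that translation by \<open>x\<close>
  multiplies by \<open>z\<close>.
\<close>

lemma translation_average_eigenfunction:
  fixes f :: "int \<Rightarrow> complex" and z :: complex
  assumes per: "\<And>m. f (m + q) = f m" and x: "[x ^ n = 1] (mod q)" and z: "z ^ n = 1" "n > 0"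
  defines "h \<equiv> \<lambda>a. \<Sum>i<n. cnj z ^ i * f (x ^ i * a)"
  shows "h (x * a) = z * h a"
proof -
  have unit: "z * cnj z = 1" by (rule root_of_unity_times_cnj[OF z])
  have "cnj z ^ n = 1" using z(1) by (metis complex_cnj_one complex_cnj_power)
  moreover have "f (x ^ n * a) = f (1 * a)"
    by (rule periodic_cong[of f q, OF per]) (intro cong_mult x cong_refl)
  ultimately have cyc: "(\<Sum>i<n. cnj z ^ Suc i * f (x ^ Suc i * a)) = h a"
    unfolding h_def by (intro sum_lessThan_shift_cyclic) simp
  have "h (x * a) = (\<Sum>i<n. (z * cnj z) * (cnj z ^ i * f (x ^ Suc i * a)))"
    unfolding h_def unit by (simp add: mult_ac)
  also have "\<dots> = z * (\<Sum>i<n. cnj z ^ Suc i * f (x ^ Suc i * a))"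
    by (simp add: sum_distrib_left mult_ac)
  finally show ?thesis unfolding cyc .
qed

text \<open>
  Translations by units commute and have finite order, so they can be diagonalised together. The projections
  of a function onto the eigenspaces of one translation add up to a multiple of the function, so one of
  them does not vanish at \<open>u\<close>; it keeps the eigenvalues of all translations treated before.
\<close>

lemma joint_translation_eigenfunction:
  fixes f :: "int \<Rightarrow> complex"
  assumes q: "q > 0" and "finite X" "\<And>x. x \<in> X \<Longrightarrow> coprime x (int q)"
    and per: "\<And>m. f (m + int q) = f m" and nz: "coprime u (int q)" "f u \<noteq> 0"
    and eig: "\<And>a. f (g * a) = \<zeta> * f a"
  shows "\<exists>h. (\<forall>m. h (m + int q) = h m) \<and> h u \<noteq> 0 \<and> (\<forall>a. h (g * a) = \<zeta> * h a) \<and>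
             (\<forall>x\<in>X. \<exists>\<mu>::complex. \<forall>a. h (x * a) = \<mu> * h a)"
  using assms(2,3)
proof (induction X)
  case empty
  then show ?case using per nz eig by auto
next
  case (insert x X)
  then obtain h where h: "\<And>m. h (m + int q) = h m" "h u \<noteq> 0" "\<And>a. h (g * a) = \<zeta> * h a"
    "\<And>y. y \<in> X \<Longrightarrow> \<exists>\<mu>. \<forall>a. h (y * a) = \<mu> * h a"
    by (metis insertI2)
  define n where "n = totient q"
  have n: "n > 0" using q by (simp add: n_def)
  have xn: "[x ^ n = 1] (mod int q)" unfolding n_def using insert.prems by (intro int_euler_theorem) auto
  define \<omega> where "\<omega> = cis (2 * pi / real n)"
  define h' where "h' k a = (\<Sum>i<n. cnj (\<omega> ^ k) ^ i * h (x ^ i * a))" for k a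
  have \<omega>: "\<omega> ^ n = 1" unfolding \<omega>_def Complex.DeMoivre using n by simp
  have \<omega>i: "cnj \<omega> ^ i \<noteq> 1" if "0 < i" "i < n" for i
  proof
    assume "cnj \<omega> ^ i = 1"
    then have "\<omega> ^ i = 1" by (metis complex_cnj_cnj complex_cnj_one complex_cnj_power)
    then show False using cis_primitive_root[OF that] by (simp add: \<omega>_def)
  qed
  have "(\<Sum>k<n. h' k u) = (\<Sum>i<n. (\<Sum>k<n. (cnj \<omega> ^ i) ^ k) * h (x ^ i * u))"
    unfolding h'_def sum_distrib_right
    by (subst sum.swap, intro sum.cong refl) (simp add: mult.commute flip: power_mult)
  also have "\<dots> = (\<Sum>i<n. if i = 0 then of_nat n * h u else 0)"
  proof (intro sum.cong refl)
    fix i assume i: "i \<in> {..<n}"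
    have "(cnj \<omega> ^ i) ^ n = 1"
      using \<omega> by (metis complex_cnj_one complex_cnj_power mult.commute power_mult power_one)
    then show "(\<Sum>k<n. (cnj \<omega> ^ i) ^ k) * h (x ^ i * u) = (if i = 0 then of_nat n * h u else 0)"
      using \<omega>i[of i] i by (simp add: sum_powers_root_of_unity)
  qed
  also have "\<dots> = of_nat n * h u" using n by simp
  finally have "(\<Sum>k<n. h' k u) \<noteq> 0" using h(2) n by simp
  then obtain k where k: "h' k u \<noteq> 0" by (metis sum.neutral)
  have pow: "(\<omega> ^ k) ^ n = 1" using \<omega> by (metis mult.commute power_mult power_one)
  have scale: "h' k (y * a) = \<mu> * h' k a" if "\<And>a. h (y * a) = \<mu> * h a" for y \<mu> a
  proof -
    have "h (x ^ i * (y * a)) = \<mu> * h (x ^ i * a)" for i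
      using that[of "x ^ i * a"] by (simp add: mult_ac)
    then show ?thesis unfolding h'_def by (simp add: sum_distrib_left mult_ac)
  qed
  show ?case
  proof (intro exI[of _ "h' k"] conjI allI ballI)
    have "h (x ^ i * (m + int q)) = h (x ^ i * m)" for i m
      by (rule periodic_cong[of h "int q", OF h(1)]) (simp add: cong_def distrib_left)
    then show "h' k (m + int q) = h' k m" for m
      by (simp add: h'_def)
    show "h' k (g * a) = \<zeta> * h' k a" for a by (rule scale[OF h(3)])
    show "\<exists>\<mu>. \<forall>a. h' k (y * a) = \<mu> * h' k a" if "y \<in> insert x X" for y
    proof (cases "y = x")
      case True
      then show ?thesis
        using translation_average_eigenfunction[of h "int q" x n "\<omega> ^ k", OF h(1) xn pow n]
        unfolding h'_def by blast
    next
      case False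
      then show ?thesis using that h(4)[of y] scale by blast
    qed
  qed (use k in auto)
qed

text \<open>
  A joint eigenfunction of all translations, normalised to be \<open>1\<close> at \<open>1\<close>, is a character. Starting the
  diagonalisation from the function that is \<open>\<zeta>\<^sup>i\<close> at \<open>g\<^sup>i\<close> and \<open>0\<close> at the other units prescribes the value
  at \<open>g\<close>. This replaces the extension of characters from a subgroup.
\<close>

lemma dirichlet_character_with_value:
  assumes q: "q > 1" and g: "coprime g (int q)" and r: "r > 0" "[g ^ r = 1] (mod int q)"
    and min: "\<And>i. \<lbrakk>0 < i; i < r\<rbrakk> \<Longrightarrow> \<not> [g ^ i = 1] (mod int q)" and \<zeta>: "\<zeta> ^ r = 1"
  shows "\<exists>\<psi>. dirichlet_character q \<psi> \<and> \<psi> g = \<zeta>"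
proof -
  define \<delta> where "\<delta> a = (if [a = 1] (mod int q) then 1 else 0 :: complex)" for a
  \<comment> \<open>The projection, up to a factor \<open>r\<close>, of the indicator function of the class of \<open>1\<close> onto the eigenspace
      of translation by \<open>g\<close> with eigenvalue \<open>\<zeta>\<close>.\<close>
  define f where "f a = (\<Sum>i<r. cnj \<zeta> ^ i * \<delta> (g ^ i * a))" for a
  have \<delta>per: "\<delta> (m + int q) = \<delta> m" for m by (simp add: \<delta>_def cong_def)
  have "\<delta> (g ^ i * (m + int q)) = \<delta> (g ^ i * m)" for i m
    by (rule periodic_cong[of \<delta> "int q", OF \<delta>per]) (simp add: cong_def distrib_left)
  then have fper: "f (m + int q) = f m" for m
    by (simp add: f_def)
  have feig: "f (g * a) = \<zeta> * f a" for a
    unfolding f_def by (rule translation_average_eigenfunction[of \<delta> "int q", OF \<delta>per r(2) \<zeta> r(1)])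
  have "f 1 = (\<Sum>i<r. if i = 0 then 1 else 0)"
    unfolding f_def using min by (intro sum.cong) (auto simp: \<delta>_def)
  then have f1: "f 1 \<noteq> 0" using r(1) by simp
  define X where "X = {0..<int q} \<inter> {x. coprime x (int q)}"
  have "\<exists>h. (\<forall>m. h (m + int q) = h m) \<and> h 1 \<noteq> 0 \<and> (\<forall>a. h (g * a) = \<zeta> * h a) \<and>
             (\<forall>x\<in>X. \<exists>\<mu>::complex. \<forall>a. h (x * a) = \<mu> * h a)"
    by (rule joint_translation_eigenfunction[of q X f 1 g \<zeta>, OF _ _ _ fper _ f1 feig])
       (use q in \<open>simp_all add: X_def\<close>)
  then obtain h where h: "\<And>m. h (m + int q) = h m" "h 1 \<noteq> 0" "\<And>a. h (g * a) = \<zeta> * h a"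
    and eig: "\<And>x. x \<in> X \<Longrightarrow> \<exists>\<mu>. \<forall>a. h (x * a) = \<mu> * h a" by metis
  have mult: "h (m * n) * h 1 = h m * h n" if m: "coprime m (int q)" for m n
  proof -
    have mod: "h (m * n) = h (m mod int q * n)" for n
      by (rule periodic_cong[of h "int q"]) (auto simp: h(1) cong_def mod_mult_left_eq)
    have "coprime (m mod int q) (int q)" using m q by simp
    then obtain \<mu> where \<mu>: "\<And>a. h (m mod int q * a) = \<mu> * h a" using eig[of "m mod int q"] q unfolding X_def by auto
    then show ?thesis using mod[of n] mod[of 1] \<mu>[of n] \<mu>[of 1] by simp
  qed
  have nz: "h m \<noteq> 0" if m: "coprime m (int q)" for m
  proof -
    obtain m' where "[m * m' = 1] (mod int q)" using m by (metis cong_solve_coprime_int)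
    then have "h (m * m') = h 1" by (rule periodic_cong[of h "int q", OF h(1)])
    then show ?thesis using mult[OF m, of m'] h(2) by auto
  qed
  define \<psi> where "\<psi> m = (if coprime m (int q) then h m / h 1 else 0)" for m
  have "dirichlet_character q \<psi>"
    unfolding dirichlet_character_def
  proof (intro conjI allI)
    show "\<psi> (m * n) = \<psi> m * \<psi> n" for m n
      using mult[of m n] h(2) by (auto simp: \<psi>_def field_simps)
    have "coprime (m + int q) (int q) = coprime m (int q)" for m
      by (simp add: coprime_iff_gcd_eq_1)
    then show "\<psi> (m + int q) = \<psi> m" for m
      by (simp add: \<psi>_def h(1))
    show "(\<psi> m = 0) = (\<not> coprime m (int q))" for m
      using nz h(2) by (auto simp: \<psi>_def)
  qed
  moreover have "\<psi> g = \<zeta>" using g h(3)[of 1] h(2) by (simp add: \<psi>_def)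
  ultimately show ?thesis by blast
qed

lemma dirichlet_character_power:
  assumes "dirichlet_character q \<psi>" "m > 0"
  shows "dirichlet_character q (\<lambda>a. \<psi> a ^ m)"
  using assms unfolding dirichlet_character_def by (simp add: power_mult_distrib)

lemma dirichlet_character_eq_root:
  assumes \<psi>: "dirichlet_character q \<psi>" and a: "coprime a (int q)"
  shows "\<psi> a ^ totient q = 1"
proof -
  have 1: "\<psi> 1 = 1" using \<psi> unfolding dirichlet_character_def
    by (metis coprime_1_left mult_cancel_right2 mult_1)
  have pow: "\<psi> (a ^ n) = \<psi> a ^ n" for n
    by (induction n) (use \<psi> 1 in \<open>auto simp: dirichlet_character_def\<close>)
  have "\<psi> (a ^ totient q) = \<psi> 1"
    by (rule periodic_cong[of \<psi> "int q", OF _ int_euler_theorem[OF a]])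
       (use \<psi> in \<open>simp add: dirichlet_character_def\<close>)
  then show ?thesis using pow 1 by simp
qed

text \<open>
  Periodicity and Euler's theorem leave finitely many values at finitely many arguments. Finiteness matters because
  sums over the characters would otherwise be \<open>0\<close> by convention.
\<close>

lemma finite_nonprincipal_characters:
  assumes "q > 0"
  shows "finite (nonprincipal_characters q)"
proof -
  let ?R = "insert 0 {z::complex. z ^ totient q = 1}"
  have "inj_on (\<lambda>\<psi>. restrict \<psi> {0..<int q}) (nonprincipal_characters q)"
  proof (rule inj_onI, rule ext)
    fix \<psi> \<psi>' m assume \<psi>: "\<psi> \<in> nonprincipal_characters q" "\<psi>' \<in> nonprincipal_characters q"
      and eq: "restrict \<psi> {0..<int q} = restrict \<psi>' {0..<int q}"
    have "\<xi> m = \<xi> (m mod int q)" if "\<xi> \<in> nonprincipal_characters q" for \<xi>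
      by (rule periodic_cong[of \<xi> "int q"])
         (use that in \<open>simp_all add: nonprincipal_characters_def dirichlet_character_def cong_def\<close>)
    moreover have "\<psi> (m mod int q) = \<psi>' (m mod int q)"
      using fun_cong[OF eq, of "m mod int q"] assms by simp
    ultimately show "\<psi> m = \<psi>' m" using \<psi> by metis
  qed
  moreover have "(\<lambda>\<psi>. restrict \<psi> {0..<int q}) ` nonprincipal_characters q \<subseteq> PiE {0..<int q} (\<lambda>_. ?R)"
  proof (intro image_subsetI PiE_I)
    fix \<psi> m assume "\<psi> \<in> nonprincipal_characters q" "m \<in> {0..<int q}"
    then have "dirichlet_character q \<psi>" by (simp add: nonprincipal_characters_def)
    then have "\<psi> m \<in> ?R"
      using dirichlet_character_eq_root[of q \<psi> m] unfolding dirichlet_character_def by blast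
    then show "restrict \<psi> {0..<int q} m \<in> ?R" using \<open>m \<in> {0..<int q}\<close> by simp
  qed auto
  moreover have "finite (PiE {0..<int q} (\<lambda>_. ?R))"
    using assms finite_roots_unity[of "totient q"] by (intro finite_PiE) auto
  ultimately show ?thesis by (meson finite_imageD finite_subset)
qed

text \<open>
  The character sends a generator of \<open>G\<close> to a primitive root of unity of order \<open>|G|\<close>, which makes it injective on \<open>G\<close>.
\<close>

lemma cyclic_subgroup_faithful_character:
  assumes q: "q > 1" and sub: "subgroup G (reduced_residues q)"
    and cyc: "cyclic_group ((reduced_residues q)\<lparr>carrier := G\<rparr>)"
  shows "\<exists>\<psi>. dirichlet_character q \<psi> \<and> inj_on \<psi> G \<and> (\<forall>a\<in>G. \<psi> a ^ card G = 1) \<and>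
           (\<exists>g\<in>G. \<forall>m. 0 < m \<longrightarrow> m < card G \<longrightarrow> \<psi> g ^ m \<noteq> 1)"
proof -
  interpret R: residues "int q" "residue_ring (int q)"
    by unfold_locales (use q in auto)
  interpret U: group "reduced_residues q" by (rule R.units_group)
  define H where "H = (reduced_residues q)\<lparr>carrier := G\<rparr>"
  interpret H: group H unfolding H_def by (rule subgroup.subgroup_is_group[OF sub U.is_group])
  have carH: "carrier H = G" by (simp add: H_def)
  have one: "\<one>\<^bsub>H\<^esub> = 1" by (simp add: H_def units_of_one R.res_one_eq)
  have mult: "x \<otimes>\<^bsub>H\<^esub> y = x * y mod int q" for x y
    by (simp add: H_def units_of_mult R.res_mult_eq)
  have pow: "x [^]\<^bsub>H\<^esub> n = x ^ n mod int q" for x and n :: nat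
    by (induction n) (use q in \<open>simp_all add: one mult mod_mult_left_eq mod_mult_right_eq mult.commute\<close>)
  have units: "G \<subseteq> {x. 0 < x \<and> x < int q \<and> coprime x (int q)}"
    using subgroup.subset[OF sub] R.res_units_eq by (simp add: units_of_carrier)
  have fin: "finite (carrier H)"
    unfolding carH by (rule finite_subset[OF units]) (rule finite_subset[of _ "{0..int q}"], auto)
  obtain g where g: "g \<in> G" and gen: "subgroup_generated H {g} = H"
    using cyc unfolding cyclic_group_def H_def[symmetric] carH by blast
  have gH: "g \<in> carrier H" using g carH by simp
  have "carrier (subgroup_generated H {g}) = generate H {g}"
    using gH by (simp add: carrier_subgroup_generated)
  then have gen': "G = generate H {g}" using gen carH by simp
  define r where "r = card G"
  have r: "H.ord g = r" unfolding r_def gen' by (rule H.generate_pow_card[OF gH])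
  have r0: "r > 0" using fin g carH by (auto simp: r_def card_gt_0_iff)
  have elem: "\<exists>k. a = g ^ k mod int q" if "a \<in> G" for a
    using that H.generate_pow_on_finite_carrier[OF fin gH] unfolding gen' by (auto simp: pow)
  have eq1: "[g ^ k = 1] (mod int q) \<longleftrightarrow> r dvd k" for k
    using H.pow_eq_id[OF gH, of k] q by (simp add: pow one r cong_def)
  have gco: "coprime g (int q)" using units g by auto
  have "cis (2 * pi / real r) ^ r = 1" unfolding Complex.DeMoivre using r0 by simp
  then obtain \<psi> where \<psi>: "dirichlet_character q \<psi>" and \<psi>g: "\<psi> g = cis (2 * pi / real r)"
    using dirichlet_character_with_value[OF q gco r0, of "cis (2 * pi / real r)"] eq1
    by (metis dvd_refl nat_dvd_not_less)
  have prim: "\<psi> g ^ m \<noteq> 1" if "0 < m" "m < r" for m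
    unfolding \<psi>g by (rule cis_primitive_root[OF that])
  have 1: "\<psi> 1 = 1" using \<psi> unfolding dirichlet_character_def
    by (metis coprime_1_left mult_cancel_right2)
  have \<psi>pow: "\<psi> (g ^ k mod int q) = \<psi> g ^ k" for k
  proof -
    have "\<psi> (g ^ k mod int q) = \<psi> (g ^ k)"
      by (rule periodic_cong[of \<psi> "int q"]) (use \<psi> in \<open>simp_all add: dirichlet_character_def\<close>)
    also have "\<psi> (g ^ k) = \<psi> g ^ k"
      by (induction k) (use \<psi> 1 in \<open>simp_all add: dirichlet_character_def\<close>)
    finally show ?thesis .
  qed
  have gr: "\<psi> g ^ r = 1" using \<psi>pow[of r] eq1[of r] 1 q by (simp add: cong_def)
  have root: "\<psi> a ^ r = 1" if "a \<in> G" for a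
    using elem[OF that] \<psi>pow gr by (metis mult.commute power_mult power_one)
  have "inj_on \<psi> G"
  proof (rule inj_onI)
    fix a b assume ab: "a \<in> G" "b \<in> G" "\<psi> a = \<psi> b"
    have wlog: "g ^ k mod int q = g ^ l mod int q" if "\<psi> g ^ k = \<psi> g ^ l" "k \<le> l" for k l
    proof -
      have "\<psi> g ^ (l - k) = 1" using that prim \<psi>g by (simp add: power_diff)
      then have "\<psi> g ^ ((l - k) mod r) = 1"
        using gr by (metis mod_mult_div_eq mult_1_right power_add power_mult power_one)
      then have "r dvd l - k" using prim[of "(l - k) mod r"] r0 by (auto simp: dvd_eq_mod_eq_0)
      then have "[g ^ k * g ^ (l - k) = g ^ k * 1] (mod int q)" using eq1 by (intro cong_mult) auto
      then show ?thesis using that(2) by (simp add: cong_def flip: power_add)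
    qed
    obtain k l where "a = g ^ k mod int q" "b = g ^ l mod int q" using elem ab by metis
    then show "a = b" using ab(3) wlog[of k l] wlog[of l k] \<psi>pow by (metis nle_le)
  qed
  then show ?thesis using \<psi> root prim g unfolding r_def by blast
qed

lemma dirichlet_character_inverse:
  assumes q: "q > 1" and \<psi>: "dirichlet_character q \<psi>" and a: "a \<in> carrier (reduced_residues q)"
  shows "\<psi> (inv\<^bsub>reduced_residues q\<^esub> a) = cnj (\<psi> a)"
proof -
  interpret R: residues "int q" "residue_ring (int q)"
    by unfold_locales (use q in auto)
  interpret U: group "reduced_residues q" by (rule R.units_group)
  let ?b = "inv\<^bsub>reduced_residues q\<^esub> a"
  have "a * ?b mod int q = 1"
    using U.r_inv[OF a] by (simp add: units_of_mult units_of_one R.res_mult_eq R.res_one_eq)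
  then have "[a * ?b = 1] (mod int q)" using q by (simp add: cong_def)
  then have "\<psi> (a * ?b) = \<psi> 1"
    by (rule periodic_cong[of \<psi> "int q", rotated]) (use \<psi> in \<open>simp add: dirichlet_character_def\<close>)
  moreover have "\<psi> 1 = 1" using \<psi> unfolding dirichlet_character_def
    by (metis coprime_1_left mult_cancel_right2)
  ultimately have "\<psi> a * \<psi> ?b = 1" using \<psi> by (simp add: dirichlet_character_def)
  moreover have "coprime a (int q)" using a by (simp add: units_of_carrier R.res_units_eq)
  then have "\<psi> a * cnj (\<psi> a) = 1"
    using q by (intro root_of_unity_times_cnj[of _ "totient q"] dirichlet_character_eq_root[OF \<psi>]) auto
  ultimately show ?thesis by (metis mult.assoc mult.commute mult_1)
qed

section \<open>The size of the terms\<close>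

text \<open>
  With \<open>y = x / t\<close> the ratio is \<open>1 + ln y / ln t\<close>, and \<open>ln y\<close> is at most \<open>y powr b / b\<close>.
\<close>

lemma ln_ratio_le:
  fixes b t x :: real
  assumes "b > 0" "2 \<le> t" "t \<le> x"
  shows "ln x / ln t \<le> (1 + 1 / (b * ln 2)) * (x / t) powr b"
proof -
  define y where "y = x / t"
  have y: "y \<ge> 1" using assms by (simp add: y_def)
  have lnt: "0 < ln (2::real)" "ln 2 \<le> ln t" using assms by auto
  have "ln x = ln t + ln y" using assms by (simp add: y_def ln_div)
  then have "ln x / ln t = 1 + ln y / ln t" using lnt assms by (simp add: add_divide_distrib)
  also have "\<dots> \<le> 1 + ln y / ln 2"
    using lnt y assms by (intro add_left_mono divide_left_mono mult_pos_pos) auto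
  also have "\<dots> \<le> y powr b + (y powr b / b) / ln 2"
  proof (intro add_mono divide_right_mono)
    show "1 \<le> y powr b" using y assms(1) by (simp add: ge_one_powr_ge_zero)
    have "b * ln y = ln (y powr b)" using y by (simp add: ln_powr)
    also have "\<dots> \<le> y powr b" using y by (intro ln_bound) auto
    finally show "ln y \<le> y powr b / b" using assms(1) by (simp add: field_simps)
  qed (use lnt in auto)
  also have "\<dots> = (1 + 1 / (b * ln 2)) * y powr b" using lnt assms(1) by (simp add: field_simps)
  finally show ?thesis unfolding y_def .
qed

text \<open>
  The integral is smaller than \<open>x powr Re \<rho> / ln x\<close> by a factor \<open>ln x\<close>. By \<open>ln_ratio_le\<close> the factor
  \<open>1 / (ln t)\<^sup>2\<close> may be replaced by \<open>1 / (ln x)\<^sup>2\<close> at the cost of a constant and of the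
  factor \<open>(x / t) powr (Re \<rho> / 2)\<close>, after which the
  integrand is a power of \<open>t\<close>.
\<close>

lemma norm_secondary_integral_le:
  assumes \<beta>: "Re \<rho> > 0" and x: "2 \<le> x"
  shows "norm (integral {2..x} (\<lambda>t. of_real t powr \<rho> / of_real (t * (ln t)\<^sup>2)))
    \<le> (1 + 4 / (Re \<rho> * ln 2))\<^sup>2 * (2 / Re \<rho>) * (x powr Re \<rho> / (ln x)\<^sup>2)"
proof -
  define \<beta> where "\<beta> = Re \<rho>"
  define M where "M = (1 + 4 / (\<beta> * ln 2))\<^sup>2 * (x powr (\<beta> / 2) / (ln x)\<^sup>2)"
  have b0: "\<beta> > 0" using \<beta> by (simp add: \<beta>_def)
  have anti: "((\<lambda>t. M * t powr (\<beta> / 2 - 1)) has_integral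
      (M * (x powr (\<beta> / 2) / (\<beta> / 2)) - M * (2 powr (\<beta> / 2) / (\<beta> / 2)))) {2..x}"
    using x b0
    by (intro fundamental_theorem_of_calculus)
       (auto simp flip: has_real_derivative_iff_has_vector_derivative
             intro!: derivative_eq_intros)
  have "norm (integral {2..x} (\<lambda>t. of_real t powr \<rho> / of_real (t * (ln t)\<^sup>2)))
      \<le> integral {2..x} (\<lambda>t. M * t powr (\<beta> / 2 - 1))"
  proof (rule integral_norm_bound_integral)
    show "(\<lambda>t. of_real t powr \<rho> / of_real (t * (ln t)\<^sup>2) :: complex) integrable_on {2..x}"
      by (intro integrable_continuous_interval continuous_intros) auto
    show "(\<lambda>t. M * t powr (\<beta> / 2 - 1)) integrable_on {2..x}"
      using anti by blast
    fix t assume t: "t \<in> {2..x}"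
    then have pos: "0 < ln t" "0 < t" "0 < ln x" by auto
    \<comment> \<open>The exponent \<open>b = \<beta> / 4\<close> gives \<open>(x / t) powr (\<beta> / 2)\<close> after squaring, so that \<open>t\<close> keeps the
        exponent \<open>\<beta> / 2 - 1 > -1\<close>.\<close>
    have "(ln x / ln t)\<^sup>2 \<le> ((1 + 1 / (\<beta> / 4 * ln 2)) * (x / t) powr (\<beta> / 4))\<^sup>2"
      using t b0 pos by (intro power_mono ln_ratio_le) auto
    also have "\<dots> = (1 + 4 / (\<beta> * ln 2))\<^sup>2 * (x powr (\<beta> / 2) / t powr (\<beta> / 2))"
    proof -
      have eq: "((x / t) powr (\<beta> / 4))\<^sup>2 = (x / t) powr (\<beta> / 2)"
        using pos t by (simp add: power2_eq_square flip: powr_add)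
      then show ?thesis using pos t unfolding power_mult_distrib eq by (simp add: powr_divide)
    qed
    finally have *: "1 / (ln t)\<^sup>2 \<le> M / t powr (\<beta> / 2)"
      using pos by (simp add: M_def power_divide field_simps)
    have "norm (of_real t powr \<rho> / of_real (t * (ln t)\<^sup>2)) = t powr \<beta> / t * (1 / (ln t)\<^sup>2)"
      using pos by (simp add: norm_divide norm_powr_real_powr \<beta>_def norm_mult norm_power)
    also have "\<dots> \<le> t powr \<beta> / t * (M / t powr (\<beta> / 2))"
      using pos * by (intro mult_left_mono) auto
    also have "\<dots> = M * t powr (\<beta> / 2 - 1)"
    proof -
      have "t powr \<beta> = t powr (\<beta> / 2) * t powr (\<beta> / 2)" using pos by (simp flip: powr_add)
      then show ?thesis using pos by (simp add: powr_diff)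
    qed
    finally show "norm (of_real t powr \<rho> / of_real (t * (ln t)\<^sup>2)) \<le> M * t powr (\<beta> / 2 - 1)" .
  qed
  also have "\<dots> = M * (x powr (\<beta> / 2) / (\<beta> / 2)) - M * (2 powr (\<beta> / 2) / (\<beta> / 2))"
    using anti by (rule integral_unique)
  also have "\<dots> \<le> M * (x powr (\<beta> / 2) / (\<beta> / 2))"
    using b0 by (auto simp: M_def intro!: divide_nonneg_nonneg mult_nonneg_nonneg)
  also have "\<dots> = (1 + 4 / (\<beta> * ln 2))\<^sup>2 * (2 / \<beta>) * ((x powr (\<beta> / 2) * x powr (\<beta> / 2)) / (ln x)\<^sup>2)"
    by (simp add: M_def mult_ac)
  also have "x powr (\<beta> / 2) * x powr (\<beta> / 2) = x powr \<beta>"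
    using x by (simp flip: powr_add)
  finally show ?thesis unfolding \<beta>_def .
qed

lemma f_term_normalized_tendsto:
  assumes "Re \<rho> > 0"
  shows "((\<lambda>x. f_term x \<rho> * of_real (ln x / x powr Re \<rho>) - cis (Im \<rho> * ln x) / \<rho>) \<longlongrightarrow> 0) at_top"
proof -
  define C where "C = (1 + 4 / (Re \<rho> * ln 2))\<^sup>2 * (2 / Re \<rho>)"
  have bound: "norm (f_term x \<rho> * of_real (ln x / x powr Re \<rho>) - cis (Im \<rho> * ln x) / \<rho>)
          \<le> norm (1 / \<rho>) * C / ln x" if x: "x \<ge> 2" for x
  proof -
    define J where "J = (integral {2..x} (\<lambda>t. of_real t powr \<rho> / of_real (t * (ln t)\<^sup>2)) :: complex)"
    have pos: "ln x > 0" "x > 0" "x powr Re \<rho> > 0" using x by auto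
    have "of_real x powr \<rho> = of_real (x powr Re \<rho>) * cis (Im \<rho> * ln x)"
      using pos by (simp add: powr_def Ln_of_real exp_eq_polar mult_ac flip: of_real_exp)
    then have "f_term x \<rho> = of_real (x powr Re \<rho>) * cis (Im \<rho> * ln x) / (\<rho> * of_real (ln x)) + 1 / \<rho> * J"
      by (simp add: f_term_def J_def)
    moreover have "\<rho> \<noteq> 0" using assms by auto
    ultimately have "f_term x \<rho> * of_real (ln x / x powr Re \<rho>) - cis (Im \<rho> * ln x) / \<rho>
        = 1 / \<rho> * J * of_real (ln x / x powr Re \<rho>)"
      using pos by (simp add: distrib_right add_divide_distrib)
    also have "norm \<dots> = norm (1 / \<rho>) * norm J * (ln x / x powr Re \<rho>)"
      unfolding norm_mult norm_of_real using pos by simp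
    also have "\<dots> \<le> norm (1 / \<rho>) * (C * (x powr Re \<rho> / (ln x)\<^sup>2)) * (ln x / x powr Re \<rho>)"
      using pos norm_secondary_integral_le[OF assms x, folded J_def]
      by (intro mult_right_mono mult_left_mono) (auto simp: C_def)
    also have "\<dots> = norm (1 / \<rho>) * C / ln x"
      using pos by (simp add: power2_eq_square)
    finally show ?thesis .
  qed
  show ?thesis
  proof (rule Lim_null_comparison)
    show "\<forall>\<^sub>F x in at_top. norm (f_term x \<rho> * of_real (ln x / x powr Re \<rho>) - cis (Im \<rho> * ln x) / \<rho>)
          \<le> norm (1 / \<rho>) * C / ln x"
      using eventually_ge_at_top[of 2] by eventually_elim (rule bound)
    show "((\<lambda>x. norm (1 / \<rho>) * C / ln x) \<longlongrightarrow> 0) at_top" by real_asymp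
  qed
qed

section \<open>Families close to the model race\<close>

lemma arbitrarily_large_iff_frequently:
  "arbitrarily_large A \<longleftrightarrow> (\<exists>\<^sub>F x in at_top. A x)"
proof -
  have "bdd_above {x. 0 \<le> x \<and> A x} \<longleftrightarrow> (\<exists>M. \<forall>x\<ge>M. \<not> A x)"
  proof
    assume "bdd_above {x. 0 \<le> x \<and> A x}"
    then obtain M where M: "\<And>x. 0 \<le> x \<Longrightarrow> A x \<Longrightarrow> x \<le> M" by (auto simp: bdd_above_def)
    have "\<not> A x" if "\<bar>M\<bar> + 1 \<le> x" for x
      using M[of x] that by linarith
    then have "\<forall>x\<ge>\<bar>M\<bar> + 1. \<not> A x" by blast
    then show "\<exists>M. \<forall>x\<ge>M. \<not> A x" by blast
  next
    assume "\<exists>M. \<forall>x\<ge>M. \<not> A x"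
    then obtain M where "\<And>x. x \<ge> M \<Longrightarrow> \<not> A x" by blast
    then show "bdd_above {x. 0 \<le> x \<and> A x}" unfolding bdd_above_def by (metis (mono_tags, lifting) linear mem_Collect_eq)
  qed
  then show ?thesis
    by (simp add: arbitrarily_large_def frequently_def eventually_at_top_linorder)
qed

text \<open>
  The solutions \<open>x = exp ((arcsin y + 2 \<pi> n) / \<gamma>)\<close> are unbounded.
\<close>

lemma frequently_sin_ln:
  fixes y \<gamma> :: real
  assumes "\<gamma> > 0" "-1 \<le> y" "y \<le> 1"
  shows "\<exists>\<^sub>F x in at_top. sin (\<gamma> * ln x) = y"
  unfolding frequently_def eventually_at_top_linorder
proof (safe)
  fix M assume M: "\<forall>x\<ge>M. sin (\<gamma> * ln x) \<noteq> y"
  obtain n :: nat where n: "real n > (\<gamma> * ln (max 1 M) - arcsin y) / (2 * pi)"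
    using reals_Archimedean2 by blast
  define x where "x = exp ((arcsin y + real n * (2 * pi)) / \<gamma>)"
  have "\<gamma> * ln (max 1 M) < arcsin y + real n * (2 * pi)"
    using n by (simp add: field_simps)
  then have "ln (max 1 M) < (arcsin y + real n * (2 * pi)) / \<gamma>"
    using assms(1) by (simp add: field_simps)
  then have "exp (ln (max 1 M)) < x" unfolding x_def by (subst exp_less_cancel_iff)
  then have "M \<le> x" by simp
  moreover have "\<gamma> * ln x = arcsin y + real n * (2 * pi)"
    using assms(1) by (simp add: x_def)
  then have "sin (\<gamma> * ln x) = y"
    using assms sin.plus_of_nat[of "arcsin y" n] by simp
  ultimately show False using M by blast
qed

text \<open>
  Only the signs of the differences \<open>F a x - F b x\<close> matter, so they may be multiplied by any positive \<open>c x\<close>.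
  An ordering that recurs is nearly realised by the model at some \<open>y = sin (\<gamma> ln x)\<close>, and hence, by robustness,
  realised exactly at some point of \<open>[-1, 1]\<close>. Conversely \<open>y\<close> returns to \<open>1\<close> and to \<open>-1\<close> infinitely often, and a lead of
  \<open>1\<close> in the model is not lost.
\<close>

lemma races_close_to_model:
  fixes t :: "int \<Rightarrow> nat" and F :: "int \<Rightarrow> real \<Rightarrow> real"
  assumes fin: "finite D" and inj: "inj_on t D"
    and super: "\<And>a b. \<lbrakk>a \<in> D; b \<in> D; t a < t b\<rbrakk> \<Longrightarrow> 2 * t a \<le> t b"
    and A: "\<And>a b. \<lbrakk>a \<in> D; b \<in> D\<rbrakk> \<Longrightarrow> real (t a) + real (t b) + 1 \<le> A"
    and \<gamma>: "\<gamma> > 0" and \<epsilon>: "\<epsilon> \<le> 1"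
    and robust: "\<forall>as\<in>permutations_of_set D. \<forall>y\<in>{-1..1}.
           successively (\<lambda>a b. race A t y b \<le> race A t y a + \<epsilon>) as \<longrightarrow>
           (\<exists>y\<in>{-1..1}. successively (\<lambda>a b. race A t y b \<le> race A t y a) as)"
    and close: "\<forall>\<^sub>F x in at_top. \<forall>a\<in>D. \<forall>b\<in>D. 0 < c x \<and>
        \<bar>c x * (F a x - F b x) - (race A t (sin (\<gamma> * ln x)) a - race A t (sin (\<gamma> * ln x)) b)\<bar> < \<epsilon>"
  shows "2 * num_orderings D F \<le> card D * (card D - 1) + 2"
    and "\<And>a b. \<lbrakk>a \<in> D; b \<in> D; a \<noteq> b\<rbrakk> \<Longrightarrow> arbitrarily_large (\<lambda>x. F a x > F b x)"
proof -
  have "{as \<in> permutations_of_set D. arbitrarily_large (ordering_occurs F as)} \<subseteq>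
      {as \<in> permutations_of_set D. \<exists>y\<in>{-1..1}. successively (\<lambda>a b. race A t y b \<le> race A t y a) as}"
  proof safe
    fix as assume as: "as \<in> permutations_of_set D" "arbitrarily_large (ordering_occurs F as)"
    have "\<exists>\<^sub>F x in at_top. ordering_occurs F as x \<and> (\<forall>a\<in>D. \<forall>b\<in>D. 0 < c x \<and>
        \<bar>c x * (F a x - F b x) - (race A t (sin (\<gamma> * ln x)) a - race A t (sin (\<gamma> * ln x)) b)\<bar> < \<epsilon>)"
      using as(2) close unfolding arbitrarily_large_iff_frequently
      by (rule frequently_eventually_frequently)
    then obtain x where x: "ordering_occurs F as x" "\<And>a b. a \<in> D \<Longrightarrow> b \<in> D \<Longrightarrow> 0 < c x \<and>
        \<bar>c x * (F a x - F b x) - (race A t (sin (\<gamma> * ln x)) a - race A t (sin (\<gamma> * ln x)) b)\<bar> < \<epsilon>"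
      using frequently_ex by blast
    have "successively (\<lambda>a b. race A t (sin (\<gamma> * ln x)) b \<le> race A t (sin (\<gamma> * ln x)) a + \<epsilon>) as"
    proof (rule successively_mono)
      show "successively (\<lambda>a b. F a x \<ge> F b x) as" using x(1) by (simp add: ordering_occurs_def)
      fix a b assume ab: "a \<in> set as" "b \<in> set as" "F a x \<ge> F b x"
      then have "a \<in> D" "b \<in> D" using as(1) by (auto simp: permutations_of_set_def)
      note x(2)[OF this]
      moreover from this ab(3) have "0 \<le> c x * (F a x - F b x)" by simp
      ultimately show "race A t (sin (\<gamma> * ln x)) b \<le> race A t (sin (\<gamma> * ln x)) a + \<epsilon>" by linarith
    qed
    then show "\<exists>y\<in>{-1..1}. successively (\<lambda>a b. race A t y b \<le> race A t y a) as"
      using robust as(1) by (metis atLeastAtMost_iff sin_ge_minus_one sin_le_one)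
  qed
  then have "num_orderings D F \<le>
      card {as \<in> permutations_of_set D. \<exists>y\<in>{-1..1}. successively (\<lambda>a b. race A t y b \<le> race A t y a) as}"
    unfolding num_orderings_def using fin by (intro card_mono) auto
  moreover have "2 * card {as \<in> permutations_of_set D. \<exists>y\<in>{-1..1}.
            successively (\<lambda>a b. race A t y b \<le> race A t y a) as} \<le> card D * (card D - 1) + 2"
    using A by (intro race_orderings_card[OF fin inj super]) force+
  ultimately show "2 * num_orderings D F \<le> card D * (card D - 1) + 2" by linarith
next
  fix a b assume ab: "a \<in> D" "b \<in> D" "a \<noteq> b"
  define y :: real where "y = (if t b < t a then 1 else -1)"
  have win: "1 \<le> race A t y a - race A t y b"
    unfolding y_def using ab inj A by (intro race_wins) (auto dest: inj_onD)
  have "\<exists>\<^sub>F x in at_top. sin (\<gamma> * ln x) = y"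
    by (rule frequently_sin_ln[OF \<gamma>]) (auto simp: y_def)
  then have "\<exists>\<^sub>F x in at_top. sin (\<gamma> * ln x) = y \<and> (\<forall>a\<in>D. \<forall>b\<in>D. 0 < c x \<and>
        \<bar>c x * (F a x - F b x) - (race A t (sin (\<gamma> * ln x)) a - race A t (sin (\<gamma> * ln x)) b)\<bar> < \<epsilon>)"
    using close by (rule frequently_eventually_frequently)
  then show "arbitrarily_large (\<lambda>x. F a x > F b x)"
    unfolding arbitrarily_large_iff_frequently
  proof (rule frequently_elim1)
    fix x assume "sin (\<gamma> * ln x) = y \<and> (\<forall>a\<in>D. \<forall>b\<in>D. 0 < c x \<and>
        \<bar>c x * (F a x - F b x) - (race A t (sin (\<gamma> * ln x)) a - race A t (sin (\<gamma> * ln x)) b)\<bar> < \<epsilon>)"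
    then have "0 < c x" "\<bar>c x * (F a x - F b x) - (race A t y a - race A t y b)\<bar> < \<epsilon>"
      using ab by auto
    then have "0 < c x * (F a x - F b x)" using win \<epsilon> by linarith
    then show "F b x < F a x" using \<open>0 < c x\<close> by (simp add: zero_less_mult_iff)
  qed
qed

section \<open>Systems with two points\<close>

definition two_point_system ::
  "((int \<Rightarrow> complex) \<Rightarrow> nat) \<Rightarrow> ((int \<Rightarrow> complex) \<Rightarrow> nat) \<Rightarrow> complex \<Rightarrow> complex \<Rightarrow> char_system" where
  "two_point_system n\<^sub>1 n\<^sub>2 \<rho>\<^sub>1 \<rho>\<^sub>2 \<psi> k =
     (if k < n\<^sub>1 \<psi> then Some \<rho>\<^sub>1 else if k < n\<^sub>1 \<psi> + n\<^sub>2 \<psi> then Some \<rho>\<^sub>2 else None)"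

lemma two_point_dom: "dom (two_point_system n\<^sub>1 n\<^sub>2 \<rho>\<^sub>1 \<rho>\<^sub>2 \<psi>) = {..<n\<^sub>1 \<psi> + n\<^sub>2 \<psi>}"
  by (auto simp: two_point_system_def split: if_splits)

lemma two_point_ran: "ran (two_point_system n\<^sub>1 n\<^sub>2 \<rho>\<^sub>1 \<rho>\<^sub>2 \<psi>) \<subseteq> {\<rho>\<^sub>1, \<rho>\<^sub>2}"
  by (auto simp: two_point_system_def ran_def split: if_splits)

lemma two_point_points: "points q (two_point_system n\<^sub>1 n\<^sub>2 \<rho>\<^sub>1 \<rho>\<^sub>2) \<subseteq> {\<rho>\<^sub>1, \<rho>\<^sub>2}"
  unfolding points_def using two_point_ran by (intro UN_least)

lemma two_point_mult:
  assumes "\<rho>\<^sub>1 \<noteq> \<rho>\<^sub>2"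
  shows "mult_in (two_point_system n\<^sub>1 n\<^sub>2 \<rho>\<^sub>1 \<rho>\<^sub>2) \<rho> \<psi> =
           (if \<rho> = \<rho>\<^sub>1 then n\<^sub>1 \<psi> else if \<rho> = \<rho>\<^sub>2 then n\<^sub>2 \<psi> else 0)"
proof -
  have "{k. two_point_system n\<^sub>1 n\<^sub>2 \<rho>\<^sub>1 \<rho>\<^sub>2 \<psi> k = Some \<rho>} =
      (if \<rho> = \<rho>\<^sub>1 then {..<n\<^sub>1 \<psi>} else if \<rho> = \<rho>\<^sub>2 then {n\<^sub>1 \<psi>..<n\<^sub>1 \<psi> + n\<^sub>2 \<psi>} else {})"
    using assms by (auto simp: two_point_system_def)
  then show ?thesis by (simp add: mult_in_def)
qed

lemma two_point_R:
  assumes "\<psi> \<in> nonprincipal_characters q" "n\<^sub>1 \<psi> > 0" "Re \<rho>\<^sub>1 = \<beta>" "Re \<rho>\<^sub>2 = \<beta>"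
  shows "R_minus q (two_point_system n\<^sub>1 n\<^sub>2 \<rho>\<^sub>1 \<rho>\<^sub>2) = ereal \<beta>"
    and "R_plus q (two_point_system n\<^sub>1 n\<^sub>2 \<rho>\<^sub>1 \<rho>\<^sub>2) = ereal \<beta>"
proof -
  let ?B = "two_point_system n\<^sub>1 n\<^sub>2 \<rho>\<^sub>1 \<rho>\<^sub>2"
  have "?B \<psi> 0 = Some \<rho>\<^sub>1" using assms(2) by (simp add: two_point_system_def)
  then have "\<rho>\<^sub>1 \<in> points q ?B" using assms(1) unfolding points_def by (auto intro: ranI)
  then have ne: "points q ?B \<noteq> {}" by blast
  have eq: "ereal (Re \<rho>) = ereal \<beta>" if "\<rho> \<in> points q ?B" for \<rho>
    using that two_point_points[of q n\<^sub>1 n\<^sub>2 \<rho>\<^sub>1 \<rho>\<^sub>2] assms(3,4) by auto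
  show "R_minus q ?B = ereal \<beta>" unfolding R_minus_def using ne eq by (rule INF_eq_const)
  show "R_plus q ?B = ereal \<beta>" unfolding R_plus_def using ne eq by (rule SUP_eq_const)
qed

lemma two_point_is_system:
  assumes ne: "\<rho>\<^sub>1 \<noteq> \<rho>\<^sub>2" and \<psi>: "\<psi> \<in> nonprincipal_characters q" "n\<^sub>1 \<psi> > 0"
    and Re: "Re \<rho>\<^sub>1 = \<beta>" "Re \<rho>\<^sub>2 = \<beta>" and \<beta>: "1 / 2 < \<beta>" "\<beta> \<le> 1"
    and Im: "Im \<rho>\<^sub>1 > 0" "Im \<rho>\<^sub>2 > 0"
  shows "is_system q (two_point_system n\<^sub>1 n\<^sub>2 \<rho>\<^sub>1 \<rho>\<^sub>2)" (is "is_system q ?B")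
proof -
  have "ereal (1 / 2) < R_minus q ?B \<and> R_minus q ?B \<le> R_plus q ?B \<and> R_plus q ?B \<le> 1"
    unfolding two_point_R[where n\<^sub>1 = n\<^sub>1, OF \<psi> Re] using \<beta> by (simp add: one_ereal_def)
  moreover have "\<rho> \<noteq> \<rho>\<^sub>1 \<and> \<rho> \<noteq> \<rho>\<^sub>2" if "\<rho> \<in> \<real>" for \<rho>
    using that Im by (auto elim!: Reals_cases)
  moreover have "finite {k. ?B \<psi> k = Some \<rho>}" for \<psi> \<rho>
  proof (rule finite_subset)
    show "{k. ?B \<psi> k = Some \<rho>} \<subseteq> dom (?B \<psi>)" by auto
  qed (simp add: two_point_dom)
  moreover have "finite (ran (?B \<psi>))" for \<psi>
    by (rule finite_subset[OF two_point_ran]) auto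
  moreover have "Im \<rho> \<ge> 0" if "\<rho> \<in> ran (?B \<psi>)" for \<rho> \<psi>
    using subsetD[OF two_point_ran that] Im by auto
  ultimately show ?thesis
    unfolding is_system_def two_point_dom two_point_mult[OF ne] by auto
qed

lemma two_point_P_model:
  assumes ne: "\<rho>\<^sub>1 \<noteq> \<rho>\<^sub>2" and Im: "Im \<rho>\<^sub>1 > 0" "Im \<rho>\<^sub>2 > 0"
  shows "P_model q (two_point_system n\<^sub>1 n\<^sub>2 \<rho>\<^sub>1 \<rho>\<^sub>2) a x =
    - (2 / real (totient q)) *
       Re ((\<Sum>\<psi>\<in>nonprincipal_characters q. of_nat (n\<^sub>1 \<psi>) * cnj (\<psi> a)) * f_term x \<rho>\<^sub>1
         + (\<Sum>\<psi>\<in>nonprincipal_characters q. of_nat (n\<^sub>2 \<psi>) * cnj (\<psi> a)) * f_term x \<rho>\<^sub>2)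
    + real (prime_pi x) / real (totient q)"
proof -
  let ?B = "two_point_system n\<^sub>1 n\<^sub>2 \<rho>\<^sub>1 \<rho>\<^sub>2"
  have inner: "(\<Sum>\<^sub>\<infinity>\<rho>\<in>ran (?B \<psi>). of_real (weight \<rho>) * of_nat (mult_in ?B \<rho> \<psi>) * f_term x \<rho>)
      = of_nat (n\<^sub>1 \<psi>) * f_term x \<rho>\<^sub>1 + of_nat (n\<^sub>2 \<psi>) * f_term x \<rho>\<^sub>2" for \<psi>
  proof -
    have fin: "finite (ran (?B \<psi>))" by (rule finite_subset[OF two_point_ran]) auto
    have "mult_in ?B \<rho> \<psi> = 0" if "\<rho> \<notin> ran (?B \<psi>)" for \<rho>
    proof -
      have "{k. ?B \<psi> k = Some \<rho>} = {}" using that by (auto simp: ran_def)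
      then show ?thesis by (simp add: mult_in_def)
    qed
    then have "(\<Sum>\<^sub>\<infinity>\<rho>\<in>ran (?B \<psi>). of_real (weight \<rho>) * of_nat (mult_in ?B \<rho> \<psi>) * f_term x \<rho>)
      = (\<Sum>\<rho>\<in>{\<rho>\<^sub>1, \<rho>\<^sub>2}. of_real (weight \<rho>) * of_nat (mult_in ?B \<rho> \<psi>) * f_term x \<rho>)"
      using two_point_ran fin by (subst infsum_finite[OF fin], intro sum.mono_neutral_left) auto
    moreover have "weight \<rho>\<^sub>1 = 1" "weight \<rho>\<^sub>2 = 1"
      using Im by (auto simp: weight_def elim!: Reals_cases)
    ultimately show ?thesis using ne by (simp add: two_point_mult[OF ne])
  qed
  have "(\<Sum>\<psi>\<in>nonprincipal_characters q. cnj (\<psi> a) *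
        (of_nat (n\<^sub>1 \<psi>) * f_term x \<rho>\<^sub>1 + of_nat (n\<^sub>2 \<psi>) * f_term x \<rho>\<^sub>2)) =
      (\<Sum>\<psi>\<in>nonprincipal_characters q. of_nat (n\<^sub>1 \<psi>) * cnj (\<psi> a)) * f_term x \<rho>\<^sub>1
      + (\<Sum>\<psi>\<in>nonprincipal_characters q. of_nat (n\<^sub>2 \<psi>) * cnj (\<psi> a)) * f_term x \<rho>\<^sub>2"
    unfolding sum_distrib_right sum.distrib[symmetric]
    by (intro sum.cong refl) (simp add: distrib_left mult_ac)
  then show ?thesis unfolding P_model_def inner by (simp only:)
qed

text \<open>
  The multiplicities \<open>n m\<close> are prescribed for the powers of one character; the sum over the fibre merges them if
  some powers coincide and is \<open>0\<close> at characters that are not powers.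
\<close>

definition power_multiplicity :: "('a \<Rightarrow> complex) \<Rightarrow> nat \<Rightarrow> (nat \<Rightarrow> nat) \<Rightarrow> ('a \<Rightarrow> complex) \<Rightarrow> nat" where
  "power_multiplicity \<xi> r n \<psi> = (\<Sum>m\<in>{m\<in>{1..<r}. (\<lambda>a. \<xi> a ^ m) = \<psi>}. n m)"

lemma sum_power_multiplicity:
  fixes h :: "('a \<Rightarrow> complex) \<Rightarrow> 'b::comm_semiring_1"
  assumes "finite X" "\<And>m. \<lbrakk>0 < m; m < r\<rbrakk> \<Longrightarrow> (\<lambda>a. \<xi> a ^ m) \<in> X"
  shows "(\<Sum>\<psi>\<in>X. of_nat (power_multiplicity \<xi> r n \<psi>) * h \<psi>) =
         (\<Sum>m=1..<r. of_nat (n m) * h (\<lambda>a. \<xi> a ^ m))"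
proof -
  have "(\<Sum>\<psi>\<in>X. of_nat (power_multiplicity \<xi> r n \<psi>) * h \<psi>) =
      (\<Sum>\<psi>\<in>X. \<Sum>m\<in>{m\<in>{1..<r}. (\<lambda>a. \<xi> a ^ m) = \<psi>}. of_nat (n m) * h (\<lambda>a. \<xi> a ^ m))"
    by (intro sum.cong refl) (auto simp: power_multiplicity_def sum_distrib_right intro!: sum.cong)
  also have "\<dots> = (\<Sum>m=1..<r. of_nat (n m) * h (\<lambda>a. \<xi> a ^ m))"
    using assms by (intro sum.group) auto
  finally show ?thesis .
qed

text \<open>
  In the difference of two members of the family the prime counting term cancels, and each \<open>f_term\<close> is replaced by its
  leading part \<open>x powr \<rho> / (\<rho> * ln x)\<close>.
\<close>

lemma similar_two_point_tendsto:
  assumes U: "\<And>c. U\<^sub>1 c = (\<Sum>\<psi>\<in>nonprincipal_characters q. of_nat (n\<^sub>1 \<psi>) * cnj (\<psi> c))"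
      "\<And>c. U\<^sub>2 c = (\<Sum>\<psi>\<in>nonprincipal_characters q. of_nat (n\<^sub>2 \<psi>) * cnj (\<psi> c))"
    and ne: "\<rho>\<^sub>1 \<noteq> \<rho>\<^sub>2" and Re: "Re \<rho>\<^sub>1 = \<beta>" "Re \<rho>\<^sub>2 = \<beta>" "\<beta> > 0"
    and Im: "Im \<rho>\<^sub>1 > 0" "Im \<rho>\<^sub>2 > 0"
    and F: "similar \<beta> q (two_point_system n\<^sub>1 n\<^sub>2 \<rho>\<^sub>1 \<rho>\<^sub>2) F"
    and ab: "a \<in> carrier (reduced_residues q)" "b \<in> carrier (reduced_residues q)"
  shows "((\<lambda>x. (F a x - F b x) * (ln x / x powr \<beta>) + 2 / real (totient q) *
      Re ((U\<^sub>1 a - U\<^sub>1 b) * (cis (Im \<rho>\<^sub>1 * ln x) / \<rho>\<^sub>1) + (U\<^sub>2 a - U\<^sub>2 b) * (cis (Im \<rho>\<^sub>2 * ln x) / \<rho>\<^sub>2)))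
      \<longlongrightarrow> 0) at_top"
proof -
  define P where "P = P_model q (two_point_system n\<^sub>1 n\<^sub>2 \<rho>\<^sub>1 \<rho>\<^sub>2)"
  define L where "L x = ln x / x powr \<beta>" for x :: real
  define e\<^sub>1 where "e\<^sub>1 x = f_term x \<rho>\<^sub>1 * of_real (L x) - cis (Im \<rho>\<^sub>1 * ln x) / \<rho>\<^sub>1" for x
  define e\<^sub>2 where "e\<^sub>2 x = f_term x \<rho>\<^sub>2 * of_real (L x) - cis (Im \<rho>\<^sub>2 * ln x) / \<rho>\<^sub>2" for x
  have e: "(e\<^sub>1 \<longlongrightarrow> 0) at_top" "(e\<^sub>2 \<longlongrightarrow> 0) at_top"
    using f_term_normalized_tendsto[of \<rho>\<^sub>1] f_term_normalized_tendsto[of \<rho>\<^sub>2] Re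
    unfolding e\<^sub>1_def e\<^sub>2_def L_def by simp_all
  have E: "((\<lambda>x. (F c x - P c x) * L x) \<longlongrightarrow> 0) at_top" if "c \<in> carrier (reduced_residues q)" for c
  proof -
    have "((\<lambda>x. \<bar>F c x - P c x\<bar> / (x powr \<beta> / ln x)) \<longlongrightarrow> 0) at_top"
      using F that unfolding similar_def P_def by (intro smalloD_tendsto) blast
    then have "((\<lambda>x. \<bar>\<bar>F c x - P c x\<bar> / (x powr \<beta> / ln x)\<bar>) \<longlongrightarrow> 0) at_top"
      by (rule tendsto_rabs_zero)
    then have "((\<lambda>x. \<bar>(F c x - P c x) * L x\<bar>) \<longlongrightarrow> 0) at_top"
      by (simp add: L_def abs_mult)
    then show ?thesis by (rule tendsto_rabs_zero_cancel)
  qed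
  have "((\<lambda>x. (F a x - P a x) * L x - (F b x - P b x) * L x
      - 2 / real (totient q) * Re ((U\<^sub>1 a - U\<^sub>1 b) * e\<^sub>1 x + (U\<^sub>2 a - U\<^sub>2 b) * e\<^sub>2 x))
      \<longlongrightarrow> 0 - 0 - 2 / real (totient q) * Re ((U\<^sub>1 a - U\<^sub>1 b) * 0 + (U\<^sub>2 a - U\<^sub>2 b) * 0)) at_top"
    by (intro tendsto_intros E e ab)
  moreover have "(F a x - P a x) * L x - (F b x - P b x) * L x
      - 2 / real (totient q) * Re ((U\<^sub>1 a - U\<^sub>1 b) * e\<^sub>1 x + (U\<^sub>2 a - U\<^sub>2 b) * e\<^sub>2 x)
    = (F a x - F b x) * (ln x / x powr \<beta>) + 2 / real (totient q) *
      Re ((U\<^sub>1 a - U\<^sub>1 b) * (cis (Im \<rho>\<^sub>1 * ln x) / \<rho>\<^sub>1) + (U\<^sub>2 a - U\<^sub>2 b) * (cis (Im \<rho>\<^sub>2 * ln x) / \<rho>\<^sub>2))" for x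
  proof -
    define k where "k = 2 / real (totient q)"
    define f g where "f = f_term x \<rho>\<^sub>1" and "g = f_term x \<rho>\<^sub>2"
    define c d where "c = cis (Im \<rho>\<^sub>1 * ln x) / \<rho>\<^sub>1" and "d = cis (Im \<rho>\<^sub>2 * ln x) / \<rho>\<^sub>2"
    have P: "P c x = - k * Re (U\<^sub>1 c * f + U\<^sub>2 c * g) + real (prime_pi x) / real (totient q)" for c
      unfolding P_def two_point_P_model[OF ne Im] U k_def f_def g_def ..
    have "(P a x - P b x) * L x = - k * Re ((U\<^sub>1 a - U\<^sub>1 b) * (f * of_real (L x)) + (U\<^sub>2 a - U\<^sub>2 b) * (g * of_real (L x)))"
      unfolding P by (simp add: algebra_simps)
    then show ?thesis
      unfolding k_def[symmetric] e\<^sub>1_def e\<^sub>2_def L_def[symmetric] f_def[symmetric] g_def[symmetric]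
        c_def[symmetric] d_def[symmetric]
      by (simp add: ring_distribs)
  qed
  ultimately show ?thesis by simp
qed

section \<open>Realising the model race\<close>

text \<open>
  The bounds do not involve \<open>k\<close>, which covers both points of the system: \<open>1 / \<rho>\<close> is asymptotically
  \<open>- \<i> / (k \<gamma>)\<close>.
\<close>

lemma scaled_inverse_approx:
  fixes \<beta> \<gamma> k :: real
  assumes "0 \<le> \<beta>" "0 < \<gamma>" "1 \<le> k"
  shows "norm (of_real \<gamma> / Complex \<beta> (k * \<gamma>)) \<le> 1"
    and "norm (of_real \<gamma> / Complex \<beta> (k * \<gamma>) - (- \<i> / of_real k)) \<le> \<beta> / \<gamma>"
proof -
  have k\<gamma>: "\<gamma> \<le> k * \<gamma>" using assms by simp
  have "k * \<gamma> \<le> norm (Complex \<beta> (k * \<gamma>))"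
    using abs_Im_le_cmod[of "Complex \<beta> (k * \<gamma>)"] assms by simp
  then have norm: "\<gamma> \<le> norm (Complex \<beta> (k * \<gamma>))" using k\<gamma> by linarith
  then have nz: "Complex \<beta> (k * \<gamma>) \<noteq> 0" using assms by (metis norm_zero not_le)
  show "norm (of_real \<gamma> / Complex \<beta> (k * \<gamma>)) \<le> 1"
    using norm assms nz by (simp add: norm_divide)
  have "of_real \<gamma> / Complex \<beta> (k * \<gamma>) - (- \<i> / of_real k) = \<i> * of_real \<beta> / (of_real k * Complex \<beta> (k * \<gamma>))"
    using assms nz by (simp add: divide_simps) (simp add: complex_eq_iff)
  also have "norm \<dots> = \<beta> / (k * norm (Complex \<beta> (k * \<gamma>)))"
    using assms by (simp add: norm_divide norm_mult)
  also have "\<dots> \<le> \<beta> / (1 * \<gamma>)"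
    using assms norm by (intro divide_left_mono mult_mono mult_pos_pos) auto
  finally show "norm (of_real \<gamma> / Complex \<beta> (k * \<gamma>) - (- \<i> / of_real k)) \<le> \<beta> / \<gamma>" by simp
qed

lemma norm_product_approx:
  fixes W w g h :: complex
  assumes "norm (W - w) \<le> \<delta>" "norm (g - h) \<le> \<eta>" "norm g \<le> 1" "norm w \<le> M"
  shows "norm (W * g - w * h) \<le> \<delta> + M * \<eta>"
proof -
  have "W * g - w * h = (W - w) * g + w * (g - h)" by (simp add: algebra_simps)
  also have "norm \<dots> \<le> norm (W - w) * norm g + norm w * norm (g - h)"
    by (metis norm_mult norm_triangle_ineq)
  also have "\<dots> \<le> \<delta> * 1 + M * \<eta>"
    using assms by (intro add_mono mult_mono) (auto intro: order_trans[OF norm_ge_zero])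
  finally show ?thesis by simp
qed

text \<open>
  The functions \<open>\<phi>\<^sub>1\<close> and \<open>\<phi>\<^sub>2\<close> are the Fourier targets: multiplied by \<open>- \<i>\<close> and \<open>- \<i> / 2\<close>, the limits of \<open>\<gamma> / \<rho>\<^sub>1\<close>
  and \<open>\<gamma> / \<rho>\<^sub>2\<close>, and by \<open>e\<^sup>i\<^sup>\<theta>\<close> and \<open>e\<^sup>2\<^sup>i\<^sup>\<theta>\<close>, they have real parts \<open>- A t\<^sub>a sin \<theta>\<close> and \<open>- t\<^sub>a\<^sup>2 cos 2\<theta>\<close>.
  The sign is the one in front of the sum over the points in the definition of \<open>P_model\<close>.
\<close>

lemma race_approximation:
  fixes W\<^sub>1 W\<^sub>2 g\<^sub>1 g\<^sub>2 :: complex and t :: "'a \<Rightarrow> nat" and A :: real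
  defines "\<phi>\<^sub>1 \<equiv> \<lambda>a. - complex_of_real (A * real (t a))"
    and "\<phi>\<^sub>2 \<equiv> \<lambda>a. - 2 * \<i> * of_real ((real (t a))\<^sup>2)"
  assumes W: "norm (W\<^sub>1 - (\<phi>\<^sub>1 a - \<phi>\<^sub>1 b)) \<le> \<delta>" "norm (W\<^sub>2 - (\<phi>\<^sub>2 a - \<phi>\<^sub>2 b)) \<le> \<delta>"
    and g: "norm g\<^sub>1 \<le> 1" "norm (g\<^sub>1 - (- \<i>)) \<le> \<eta>" "norm g\<^sub>2 \<le> 1" "norm (g\<^sub>2 - (- \<i> / 2)) \<le> \<eta>"
    and M: "norm (\<phi>\<^sub>1 a - \<phi>\<^sub>1 b) \<le> M" "norm (\<phi>\<^sub>2 a - \<phi>\<^sub>2 b) \<le> M"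
  shows "\<bar>Re (W\<^sub>1 * g\<^sub>1 * cis \<theta> + W\<^sub>2 * g\<^sub>2 * cis (2 * \<theta>)) + (race A t (sin \<theta>) a - race A t (sin \<theta>) b)\<bar>
          \<le> 2 * (\<delta> + M * \<eta>)"
proof -
  define v\<^sub>1 v\<^sub>2 where "v\<^sub>1 = (\<phi>\<^sub>1 a - \<phi>\<^sub>1 b) * (- \<i>)" and "v\<^sub>2 = (\<phi>\<^sub>2 a - \<phi>\<^sub>2 b) * (- \<i> / 2)"
  have model: "race A t (sin \<theta>) a - race A t (sin \<theta>) b = - Re (v\<^sub>1 * cis \<theta> + v\<^sub>2 * cis (2 * \<theta>))"
    unfolding race_def cos_double_sin[symmetric]
    by (simp add: v\<^sub>1_def v\<^sub>2_def \<phi>\<^sub>1_def \<phi>\<^sub>2_def algebra_simps)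
  have "\<bar>Re (W\<^sub>1 * g\<^sub>1 * cis \<theta> + W\<^sub>2 * g\<^sub>2 * cis (2 * \<theta>)) + (race A t (sin \<theta>) a - race A t (sin \<theta>) b)\<bar>
      = \<bar>Re ((W\<^sub>1 * g\<^sub>1 - v\<^sub>1) * cis \<theta> + (W\<^sub>2 * g\<^sub>2 - v\<^sub>2) * cis (2 * \<theta>))\<bar>"
    unfolding model by (simp add: algebra_simps)
  also have "\<dots> \<le> norm ((W\<^sub>1 * g\<^sub>1 - v\<^sub>1) * cis \<theta> + (W\<^sub>2 * g\<^sub>2 - v\<^sub>2) * cis (2 * \<theta>))"
    by (rule abs_Re_le_cmod)
  also have "\<dots> \<le> norm (W\<^sub>1 * g\<^sub>1 - v\<^sub>1) + norm (W\<^sub>2 * g\<^sub>2 - v\<^sub>2)"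
    by (rule order_trans[OF norm_triangle_ineq]) (simp add: norm_mult)
  also have "\<dots> \<le> (\<delta> + M * \<eta>) + (\<delta> + M * \<eta>)"
    unfolding v\<^sub>1_def v\<^sub>2_def by (intro add_mono norm_product_approx W g M)
  finally show ?thesis by simp
qed

text \<open>
  The constants are chosen in the order \<open>t\<close>, \<open>A\<close>, \<open>\<epsilon>\<close>, \<open>N\<close>, the multiplicities, and last \<open>\<gamma>\<close>. Only \<open>\<gamma>\<close>
  depends on \<open>\<tau>\<close>, so the number of points is bounded independently of \<open>\<tau>\<close>.
\<close>

lemma extremal_barrier_from_character:
  fixes \<xi> :: "int \<Rightarrow> complex"
  assumes q: "q > 0" and nonprincipal: "\<And>m. \<lbrakk>0 < m; m < r\<rbrakk> \<Longrightarrow> (\<lambda>a. \<xi> a ^ m) \<in> nonprincipal_characters q"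
    and r: "r \<ge> 2" and fin: "finite D" and D: "D \<subseteq> carrier (reduced_residues q)"
    and root: "\<And>a. a \<in> D \<Longrightarrow> \<xi> a ^ r = 1 \<and> \<xi> a \<noteq> 1"
    and inj: "\<And>a b. \<lbrakk>a \<in> D; b \<in> D; \<xi> b = \<xi> a \<or> \<xi> b = cnj (\<xi> a)\<rbrakk> \<Longrightarrow> a = b"
  shows "\<exists>K::nat. \<forall>\<tau>::real. \<tau> > 0 \<longrightarrow>
    (\<exists>B. is_system q B \<and> extremal_barrier q D B \<and>
         finite_system q B \<and> system_size q B \<le> K \<and> (\<forall>\<rho>\<in>points q B. Im \<rho> \<ge> \<tau>))"
proof -
  have finNP: "finite (nonprincipal_characters q)" by (rule finite_nonprincipal_characters[OF q])
  \<comment> \<open>The model contains the conjugates of the character values.\<close>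
  define \<zeta> where "\<zeta> a = cnj (\<xi> a)" for a
  have \<zeta>root: "\<zeta> a ^ r = 1 \<and> \<zeta> a \<noteq> 1" if "a \<in> D" for a
    using root[OF that] unfolding \<zeta>_def
    by (metis complex_cnj_cnj complex_cnj_one complex_cnj_power)
  have \<zeta>inj: "a = b" if "a \<in> D" "b \<in> D" "\<zeta> b = \<zeta> a \<or> \<zeta> b = cnj (\<zeta> a)" for a b
    using that inj[of a b] unfolding \<zeta>_def by (metis complex_cnj_cnj)
  \<comment> \<open>The only non-trivial real root of unity is \<open>-1\<close>, so at most one element of \<open>D\<close> has a real value.\<close>
  have real_unique: "a = b" if "a \<in> D" "b \<in> D" "cnj (\<zeta> a) = \<zeta> a" "cnj (\<zeta> b) = \<zeta> b" for a b
  proof -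
    have "\<zeta> c = -1" if "c \<in> D" "cnj (\<zeta> c) = \<zeta> c" for c
    proof -
      have "\<zeta> c * \<zeta> c = 1"
        using root_of_unity_times_cnj[of "\<zeta> c" r] \<zeta>root[OF that(1)] that(2) r by simp
      then show ?thesis using \<zeta>root[OF that(1)] by (metis square_eq_1_iff)
    qed
    then show ?thesis using that \<zeta>inj by metis
  qed
  obtain e :: "int \<Rightarrow> nat" where e: "inj_on e D"
    using finite_imp_inj_to_nat_seg[OF fin] by blast
  \<comment> \<open>The target \<open>\<phi>\<^sub>2\<close> below is imaginary, but has to be real where \<open>\<zeta>\<close> is real; hence the
      value \<open>0\<close> there.\<close>
  define t where "t a = (if cnj (\<zeta> a) = \<zeta> a then 0 else 2 ^ e a :: nat)" for a
  have inj_t: "inj_on t D"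
  proof (rule inj_onI)
    fix a b assume "a \<in> D" "b \<in> D" "t a = t b"
    then show "a = b" using real_unique[of a b] e
      by (auto simp: t_def inj_on_def split: if_splits)
  qed
  have super: "2 * t a \<le> t b" if "a \<in> D" "b \<in> D" "t a < t b" for a b
  proof -
    have "2 * 2 ^ i \<le> (2 ^ j :: nat)" if "i < j" for i j :: nat
      using power_increasing[of "Suc i" j "2::nat"] that by simp
    then show ?thesis using that by (auto simp: t_def split: if_splits)
  qed
  define A where "A = 2 * (\<Sum>a\<in>D. real (t a)) + 1"
  have A: "real (t a) + real (t b) + 1 \<le> A" if "a \<in> D" "b \<in> D" for a b
  proof -
    have "real (t c) \<le> (\<Sum>a\<in>D. real (t a))" if "c \<in> D" for c
      using fin that by (intro member_le_sum) auto
    from this[OF that(1)] this[OF that(2)] show ?thesis by (simp add: A_def)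
  qed
  have "\<forall>\<^sub>F \<epsilon> in at_right 0. \<forall>as\<in>permutations_of_set D. \<forall>y\<in>{-1..1}.
           successively (\<lambda>a b. race A t y b \<le> race A t y a + \<epsilon>) as \<longrightarrow>
           (\<exists>y\<in>{-1..1}. successively (\<lambda>a b. race A t y b \<le> race A t y a) as)"
    using fin by (rule orderings_robust) (auto simp: race_def intro!: continuous_intros)
  moreover have "\<forall>\<^sub>F \<epsilon> in at_right 0. \<epsilon> \<le> (1::real) \<and> \<epsilon> > 0"
    by (auto simp: eventually_at_right_field intro!: exI[of _ 1])
  ultimately have "\<forall>\<^sub>F \<epsilon> in at_right 0. (\<epsilon> \<le> 1 \<and> \<epsilon> > 0) \<and> (\<forall>as\<in>permutations_of_set D. \<forall>y\<in>{-1..1}.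
           successively (\<lambda>a b. race A t y b \<le> race A t y a + \<epsilon>) as \<longrightarrow>
           (\<exists>y\<in>{-1..1}. successively (\<lambda>a b. race A t y b \<le> race A t y a) as))"
    by eventually_elim blast
  from eventually_happens'[OF trivial_limit_at_right_real this]
  obtain \<epsilon> where \<epsilon>: "\<epsilon> \<le> 1" "\<epsilon> > 0" and robust: "\<forall>as\<in>permutations_of_set D. \<forall>y\<in>{-1..1}.
           successively (\<lambda>a b. race A t y b \<le> race A t y a + \<epsilon>) as \<longrightarrow>
           (\<exists>y\<in>{-1..1}. successively (\<lambda>a b. race A t y b \<le> race A t y a) as)"
    by (elim exE conjE)
  define \<phi>\<^sub>1 where "\<phi>\<^sub>1 a = - complex_of_real (A * real (t a))" for a
  define \<phi>\<^sub>2 where "\<phi>\<^sub>2 a = - 2 * \<i> * of_real ((real (t a))\<^sup>2)" for a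
  have "\<exists>C. \<forall>N>0. \<exists>n. (\<forall>m. 0 < (n m :: nat)) \<and>
           (\<forall>a\<in>D. norm ((\<Sum>m=1..<r. of_nat (n m) * \<zeta> a ^ m) / of_nat N - (\<phi>\<^sub>1 a + C)) \<le> real r / real N)"
    using r \<zeta>root \<zeta>inj by (intro positive_integer_fourier_approximation) (auto simp: \<phi>\<^sub>1_def)
  then obtain C\<^sub>1 where C\<^sub>1: "\<And>N. N > 0 \<Longrightarrow> \<exists>n. (\<forall>m. 0 < (n m :: nat)) \<and>
           (\<forall>a\<in>D. norm ((\<Sum>m=1..<r. of_nat (n m) * \<zeta> a ^ m) / of_nat N - (\<phi>\<^sub>1 a + C\<^sub>1)) \<le> real r / real N)"
    by blast
  have "\<exists>C. \<forall>N>0. \<exists>n. (\<forall>m. 0 < (n m :: nat)) \<and>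
           (\<forall>a\<in>D. norm ((\<Sum>m=1..<r. of_nat (n m) * \<zeta> a ^ m) / of_nat N - (\<phi>\<^sub>2 a + C)) \<le> real r / real N)"
    using r \<zeta>root \<zeta>inj by (intro positive_integer_fourier_approximation) (auto simp: \<phi>\<^sub>2_def t_def)
  then obtain C\<^sub>2 where C\<^sub>2: "\<And>N. N > 0 \<Longrightarrow> \<exists>n. (\<forall>m. 0 < (n m :: nat)) \<and>
           (\<forall>a\<in>D. norm ((\<Sum>m=1..<r. of_nat (n m) * \<zeta> a ^ m) / of_nat N - (\<phi>\<^sub>2 a + C\<^sub>2)) \<le> real r / real N)"
    by blast
  define M where "M = 2 * (\<Sum>a\<in>D. norm (\<phi>\<^sub>1 a) + norm (\<phi>\<^sub>2 a))"
  have M0: "0 \<le> M" by (auto simp: M_def intro!: sum_nonneg)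
  have M: "norm (\<phi>\<^sub>1 a - \<phi>\<^sub>1 b) \<le> M" "norm (\<phi>\<^sub>2 a - \<phi>\<^sub>2 b) \<le> M" if "a \<in> D" "b \<in> D" for a b
  proof -
    have le: "norm (\<phi>\<^sub>1 c) + norm (\<phi>\<^sub>2 c) \<le> M / 2" if "c \<in> D" for c
      using fin that member_le_sum[of c D "\<lambda>a. norm (\<phi>\<^sub>1 a) + norm (\<phi>\<^sub>2 a)"] by (simp add: M_def)
    show "norm (\<phi>\<^sub>1 a - \<phi>\<^sub>1 b) \<le> M" "norm (\<phi>\<^sub>2 a - \<phi>\<^sub>2 b) \<le> M"
      using le[OF that(1)] le[OF that(2)] norm_triangle_ineq4[of "\<phi>\<^sub>1 a" "\<phi>\<^sub>1 b"] norm_triangle_ineq4[of "\<phi>\<^sub>2 a" "\<phi>\<^sub>2 b"]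
        norm_ge_zero[of "\<phi>\<^sub>1 a"] norm_ge_zero[of "\<phi>\<^sub>1 b"] norm_ge_zero[of "\<phi>\<^sub>2 a"] norm_ge_zero[of "\<phi>\<^sub>2 b"]
      by linarith+
  qed
  \<comment> \<open>Rounding contributes at most \<open>4 r / N \<le> \<epsilon> / 4\<close> to the deviation from the model.\<close>
  obtain N :: nat where N16: "16 * real r / \<epsilon> < real N" using reals_Archimedean2 by blast
  have N: "N > 0"
  proof -
    have "0 \<le> 16 * real r / \<epsilon>" using \<epsilon> by simp
    then show ?thesis using N16 by linarith
  qed
  obtain n\<^sub>1 where n\<^sub>1: "\<And>m. 0 < n\<^sub>1 m"
    "\<And>a. a \<in> D \<Longrightarrow> norm ((\<Sum>m=1..<r. of_nat (n\<^sub>1 m) * \<zeta> a ^ m) / of_nat N - (\<phi>\<^sub>1 a + C\<^sub>1)) \<le> real r / real N"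
    using C\<^sub>1[OF N] by metis
  obtain n\<^sub>2 where n\<^sub>2: "\<And>m. 0 < n\<^sub>2 m"
    "\<And>a. a \<in> D \<Longrightarrow> norm ((\<Sum>m=1..<r. of_nat (n\<^sub>2 m) * \<zeta> a ^ m) / of_nat N - (\<phi>\<^sub>2 a + C\<^sub>2)) \<le> real r / real N"
    using C\<^sub>2[OF N] by metis
  define \<nu>\<^sub>1 where "\<nu>\<^sub>1 = power_multiplicity \<xi> r n\<^sub>1"
  define \<nu>\<^sub>2 where "\<nu>\<^sub>2 = power_multiplicity \<xi> r n\<^sub>2"
  define U\<^sub>1 where "U\<^sub>1 a = (\<Sum>m=1..<r. of_nat (n\<^sub>1 m) * \<zeta> a ^ m)" for a
  define U\<^sub>2 where "U\<^sub>2 a = (\<Sum>m=1..<r. of_nat (n\<^sub>2 m) * \<zeta> a ^ m)" for a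
  have U: "U\<^sub>1 a = (\<Sum>\<psi>\<in>nonprincipal_characters q. of_nat (\<nu>\<^sub>1 \<psi>) * cnj (\<psi> a))"
    "U\<^sub>2 a = (\<Sum>\<psi>\<in>nonprincipal_characters q. of_nat (\<nu>\<^sub>2 \<psi>) * cnj (\<psi> a))" for a
    unfolding U\<^sub>1_def U\<^sub>2_def \<nu>\<^sub>1_def \<nu>\<^sub>2_def \<zeta>_def
    using sum_power_multiplicity[OF finNP nonprincipal, where h = "\<lambda>\<psi>. cnj (\<psi> a)"] by simp_all
  have step: "norm ((V a - V b) / of_nat N - (\<phi> a - \<phi> b)) \<le> 2 * real r / real N"
    if "\<And>a. a \<in> D \<Longrightarrow> norm (V a / of_nat N - (\<phi> a + C)) \<le> real r / real N" "a \<in> D" "b \<in> D"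
    for V \<phi> :: "int \<Rightarrow> complex" and C a b
  proof -
    have eq: "(V a - V b) / of_nat N - (\<phi> a - \<phi> b) = (V a / of_nat N - (\<phi> a + C)) - (V b / of_nat N - (\<phi> b + C))"
      by (simp add: diff_divide_distrib)
    have "norm ((V a - V b) / of_nat N - (\<phi> a - \<phi> b)) \<le> 2 * (real r / real N)"
      unfolding eq
      using that(1)[OF that(2)] that(1)[OF that(3)]
        norm_triangle_ineq4[of "V a / of_nat N - (\<phi> a + C)" "V b / of_nat N - (\<phi> b + C)"]
      by linarith
    then show ?thesis by simp
  qed
  define K where "K = (\<Sum>m=1..<r. n\<^sub>1 m) + (\<Sum>m=1..<r. n\<^sub>2 m)"
  show ?thesis
  proof (intro exI[of _ K] allI impI)
    fix \<tau> :: real assume \<tau>: "\<tau> > 0"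
    \<comment> \<open>Replacing \<open>\<gamma> / \<rho>\<^sub>k\<close> by its limit contributes at most \<open>2 M / \<gamma> \<le> \<epsilon> / 4\<close>.\<close>
    define \<gamma> where "\<gamma> = max \<tau> (8 * M / \<epsilon> + 1)"
    have \<gamma>: "\<gamma> > 0" "\<tau> \<le> \<gamma>" using \<tau> by (auto simp: \<gamma>_def)
    have "8 * M / \<epsilon> < \<gamma>" by (simp add: \<gamma>_def less_max_iff_disj)
    then have M\<gamma>: "8 * M / \<gamma> < \<epsilon>" using \<gamma> \<epsilon> by (simp add: field_simps)
    define \<beta> :: real where "\<beta> = 3 / 4"
    define \<rho>\<^sub>1 where "\<rho>\<^sub>1 = Complex \<beta> (1 * \<gamma>)"
    define \<rho>\<^sub>2 where "\<rho>\<^sub>2 = Complex \<beta> (2 * \<gamma>)"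
    define B where "B = two_point_system \<nu>\<^sub>1 \<nu>\<^sub>2 \<rho>\<^sub>1 \<rho>\<^sub>2"
    have ne: "\<rho>\<^sub>1 \<noteq> \<rho>\<^sub>2" using \<gamma> by (simp add: \<rho>\<^sub>1_def \<rho>\<^sub>2_def)
    have Im: "Im \<rho>\<^sub>1 > 0" "Im \<rho>\<^sub>2 > 0" using \<gamma> by (simp_all add: \<rho>\<^sub>1_def \<rho>\<^sub>2_def)
    have Re: "Re \<rho>\<^sub>1 = \<beta>" "Re \<rho>\<^sub>2 = \<beta>" "\<beta> > 0" by (simp_all add: \<rho>\<^sub>1_def \<rho>\<^sub>2_def \<beta>_def)
    have \<xi>NP: "(\<lambda>a. \<xi> a ^ 1) \<in> nonprincipal_characters q" using nonprincipal[of 1] r by simp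
    have \<nu>pos: "\<nu>\<^sub>1 (\<lambda>a. \<xi> a ^ 1) > 0"
      unfolding \<nu>\<^sub>1_def power_multiplicity_def
      by (rule sum_pos2[of _ 1]) (use r n\<^sub>1(1) in auto)
    have sys: "is_system q B"
      unfolding B_def by (rule two_point_is_system[where n\<^sub>1 = \<nu>\<^sub>1, OF ne \<xi>NP \<nu>pos Re(1,2) _ _ Im]) (simp_all add: \<beta>_def)
    have Rm: "real_of_ereal (R_minus q B) = \<beta>"
      unfolding B_def two_point_R(1)[where n\<^sub>1 = \<nu>\<^sub>1, OF \<xi>NP \<nu>pos Re(1,2)] by simp
    have bound: "2 * num_orderings D F \<le> card D * (card D - 1) + 2
        \<and> (\<forall>a\<in>D. \<forall>b\<in>D. a \<noteq> b \<longrightarrow> arbitrarily_large (\<lambda>x. F a x > F b x))"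
      if F: "similar \<beta> q B F" for F
    proof -
      define c\<^sub>0 where "c\<^sub>0 = real (totient q) * \<gamma> / (2 * real N)"
      define c where "c x = c\<^sub>0 * (ln x / x powr \<beta>)" for x
      have c\<^sub>0: "c\<^sub>0 > 0" using q \<gamma> N by (simp add: c\<^sub>0_def)
      define T where "T a b x = Re ((U\<^sub>1 a - U\<^sub>1 b) / of_nat N * (of_real \<gamma> / \<rho>\<^sub>1) * cis (\<gamma> * ln x)
             + (U\<^sub>2 a - U\<^sub>2 b) / of_nat N * (of_real \<gamma> / \<rho>\<^sub>2) * cis (2 * (\<gamma> * ln x)))" for a b x
      have T_lim: "((\<lambda>x. c x * (F a x - F b x) + T a b x) \<longlongrightarrow> 0) at_top" if "a \<in> D" "b \<in> D" for a b
      proof -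
        have "((\<lambda>x. c\<^sub>0 * ((F a x - F b x) * (ln x / x powr \<beta>) + 2 / real (totient q) *
          Re ((U\<^sub>1 a - U\<^sub>1 b) * (cis (Im \<rho>\<^sub>1 * ln x) / \<rho>\<^sub>1) + (U\<^sub>2 a - U\<^sub>2 b) * (cis (Im \<rho>\<^sub>2 * ln x) / \<rho>\<^sub>2))))
          \<longlongrightarrow> c\<^sub>0 * 0) at_top"
          using that D F unfolding B_def
          by (intro tendsto_mult tendsto_const similar_two_point_tendsto[OF U ne Re Im]) auto
        moreover have "c\<^sub>0 * ((F a x - F b x) * (ln x / x powr \<beta>) + 2 / real (totient q) *
          Re ((U\<^sub>1 a - U\<^sub>1 b) * (cis (Im \<rho>\<^sub>1 * ln x) / \<rho>\<^sub>1) + (U\<^sub>2 a - U\<^sub>2 b) * (cis (Im \<rho>\<^sub>2 * ln x) / \<rho>\<^sub>2)))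
          = c x * (F a x - F b x) + T a b x" for x
        proof -
          have factor: "V / of_nat N * (of_real \<gamma> / \<rho>) * z = of_real (\<gamma> / real N) * (V * (z / \<rho>))"
            for V \<rho> z :: complex by simp
          have Re_scale: "Re (of_real k * z) = k * Re z" for k z by simp
          have Im_ln: "Im \<rho>\<^sub>1 * ln x = \<gamma> * ln x" "Im \<rho>\<^sub>2 * ln x = 2 * (\<gamma> * ln x)"
            by (simp_all add: \<rho>\<^sub>1_def \<rho>\<^sub>2_def)
          have "T a b x = Re (of_real (\<gamma> / real N) *
            ((U\<^sub>1 a - U\<^sub>1 b) * (cis (Im \<rho>\<^sub>1 * ln x) / \<rho>\<^sub>1) + (U\<^sub>2 a - U\<^sub>2 b) * (cis (Im \<rho>\<^sub>2 * ln x) / \<rho>\<^sub>2)))"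
            unfolding T_def factor Im_ln by (simp only: distrib_left)
          also have "\<dots> = (\<gamma> / real N) * Re
            ((U\<^sub>1 a - U\<^sub>1 b) * (cis (Im \<rho>\<^sub>1 * ln x) / \<rho>\<^sub>1) + (U\<^sub>2 a - U\<^sub>2 b) * (cis (Im \<rho>\<^sub>2 * ln x) / \<rho>\<^sub>2))"
            by (rule Re_scale)
          also have "\<gamma> / real N = c\<^sub>0 * (2 / real (totient q))" using q by (simp add: c\<^sub>0_def)
          finally show ?thesis unfolding c_def by (simp only: distrib_left mult_ac)
        qed
        ultimately show ?thesis by simp
      qed
      have T_close: "\<bar>T a b x + (race A t (sin (\<gamma> * ln x)) a - race A t (sin (\<gamma> * ln x)) b)\<bar> \<le> \<epsilon> / 2"
        if "a \<in> D" "b \<in> D" for a b x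
      proof -
        have "\<bar>T a b x + (race A t (sin (\<gamma> * ln x)) a - race A t (sin (\<gamma> * ln x)) b)\<bar>
            \<le> 2 * (2 * real r / real N + M * (\<beta> / \<gamma>))"
          unfolding T_def \<rho>\<^sub>1_def \<rho>\<^sub>2_def
        proof (rule race_approximation)
          show "norm ((U\<^sub>1 a - U\<^sub>1 b) / of_nat N - (- complex_of_real (A * real (t a)) - - complex_of_real (A * real (t b)))) \<le> 2 * real r / real N"
            using step[of U\<^sub>1 \<phi>\<^sub>1 C\<^sub>1, OF _ that] n\<^sub>1(2) unfolding U\<^sub>1_def \<phi>\<^sub>1_def by blast
          show "norm ((U\<^sub>2 a - U\<^sub>2 b) / of_nat N - (- 2 * \<i> * of_real ((real (t a))\<^sup>2) - - 2 * \<i> * of_real ((real (t b))\<^sup>2))) \<le> 2 * real r / real N"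
            using step[of U\<^sub>2 \<phi>\<^sub>2 C\<^sub>2, OF _ that] n\<^sub>2(2) unfolding U\<^sub>2_def \<phi>\<^sub>2_def by blast
        qed (use M[OF that] scaled_inverse_approx[of \<beta> \<gamma> 1] scaled_inverse_approx[of \<beta> \<gamma> 2] \<gamma> Re(3)
              in \<open>simp_all add: \<phi>\<^sub>1_def \<phi>\<^sub>2_def\<close>)
        also have "\<dots> \<le> \<epsilon> / 2"
        proof -
          have "16 * real r / real N < \<epsilon>" using N16 N \<epsilon> by (simp add: field_simps)
          moreover have "M * (\<beta> / \<gamma>) \<le> M / \<gamma>" using M0 \<gamma> by (simp add: \<beta>_def divide_simps)
          ultimately show ?thesis using M\<gamma> by simp
        qed
        finally show ?thesis .
      qed
      have ev: "\<forall>\<^sub>F x in at_top. \<bar>c x * (F a x - F b x) - (race A t (sin (\<gamma> * ln x)) a - race A t (sin (\<gamma> * ln x)) b)\<bar> < \<epsilon>"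
        if "a \<in> D" "b \<in> D" for a b
      proof -
        have "\<forall>\<^sub>F x in at_top. dist (c x * (F a x - F b x) + T a b x) 0 < \<epsilon> / 2"
          using T_lim[OF that] \<epsilon> by (intro tendstoD) auto
        then show ?thesis
        proof eventually_elim
          case (elim x)
          then show ?case using T_close[OF that, of x] unfolding dist_real_def by linarith
        qed
      qed
      have "\<forall>\<^sub>F x in at_top. \<forall>a\<in>D. \<forall>b\<in>D.
          \<bar>c x * (F a x - F b x) - (race A t (sin (\<gamma> * ln x)) a - race A t (sin (\<gamma> * ln x)) b)\<bar> < \<epsilon>"
        by (intro eventually_ball_finite fin ballI ev)
      moreover have "\<forall>\<^sub>F x in at_top. 0 < c x"
        using eventually_gt_at_top[of 1] by eventually_elim (use c\<^sub>0 in \<open>simp add: c_def\<close>)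
      ultimately have close: "\<forall>\<^sub>F x in at_top. \<forall>a\<in>D. \<forall>b\<in>D. 0 < c x \<and>
          \<bar>c x * (F a x - F b x) - (race A t (sin (\<gamma> * ln x)) a - race A t (sin (\<gamma> * ln x)) b)\<bar> < \<epsilon>"
        by eventually_elim blast
      show ?thesis
        using races_close_to_model[OF fin inj_t super A \<gamma>(1) \<epsilon>(1) robust close] by blast
    qed
    have cast: "real (card D * (card D - 1)) = real (card D) * (real (card D) - 1)"
      by (cases "card D") (auto simp: algebra_simps)
    have "extremal_barrier q D B"
      unfolding extremal_barrier_def KT_system_def barrier_def Rm
    proof (intro conjI allI impI)
      fix F assume "similar \<beta> q B F"
      then have "2 * num_orderings D F \<le> card D * (card D - 1) + 2" using bound by blast
      then have "2 * real (num_orderings D F) \<le> real (card D * (card D - 1)) + 2" by linarith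
      then show "\<not> real (card D) * (real (card D) - 1) / 2 + 2 \<le> real (num_orderings D F)"
        unfolding cast by simp
    qed (use bound in blast)
    moreover have "finite_system q B"
      by (simp add: finite_system_def B_def two_point_dom)
    moreover have "system_size q B \<le> K"
      using sum_power_multiplicity[OF finNP nonprincipal, where h = "\<lambda>_. 1::nat" and n = n\<^sub>1]
        sum_power_multiplicity[OF finNP nonprincipal, where h = "\<lambda>_. 1::nat" and n = n\<^sub>2]
      by (simp add: system_size_def B_def two_point_dom K_def \<nu>\<^sub>1_def \<nu>\<^sub>2_def sum.distrib)
    moreover have "Im \<rho> \<ge> \<tau>" if "\<rho> \<in> points q B" for \<rho>
      using subsetD[OF two_point_points that[unfolded B_def]] \<gamma> by (auto simp: \<rho>\<^sub>1_def \<rho>\<^sub>2_def)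
    ultimately show "\<exists>B. is_system q B \<and> extremal_barrier q D B \<and>
         finite_system q B \<and> system_size q B \<le> K \<and> (\<forall>\<rho>\<in>points q B. Im \<rho> \<ge> \<tau>)"
      using sys by blast
  qed
qed

theorem theorem4p3:
  fixes q r :: nat and G D :: "int set"
  assumes "q \<ge> 3"
    and "subgroup G (reduced_residues q)"
    and "cyclic_group ((reduced_residues q)\<lparr>carrier := G\<rparr>)"
    and "card G = r" and "r \<ge> 6"
    and "D \<subseteq> G"
    and "1 \<notin> D"
    and "\<And>a. a \<in> D \<Longrightarrow> inv\<^bsub>reduced_residues q\<^esub> a \<noteq> a \<Longrightarrow> inv\<^bsub>reduced_residues q\<^esub> a \<notin> D"
  shows "\<exists>K::nat. \<forall>\<tau>::real. \<tau> > 0 \<longrightarrow>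
    (\<exists>B. is_system q B \<and> extremal_barrier q D B \<and>
         finite_system q B \<and> system_size q B \<le> K \<and> (\<forall>\<rho>\<in>points q B. Im \<rho> \<ge> \<tau>))"
proof -
  have q: "q > 1" using assms(1) by simp
  interpret R: residues "int q" "residue_ring (int q)"
    by unfold_locales (use q in auto)
  obtain \<psi> g where \<psi>: "dirichlet_character q \<psi>" "inj_on \<psi> G" "\<And>a. a \<in> G \<Longrightarrow> \<psi> a ^ r = 1"
    and g: "g \<in> G" "\<And>m. 0 < m \<Longrightarrow> m < r \<Longrightarrow> \<psi> g ^ m \<noteq> 1"
    using cyclic_subgroup_faithful_character[OF q assms(2,3)] unfolding assms(4) by metis
  have one: "1 \<in> G"
    using subgroup.one_closed[OF assms(2)] by (simp add: units_of_one R.res_one_eq)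
  have \<psi>1: "\<psi> 1 = 1" using \<psi>(1) unfolding dirichlet_character_def
    by (metis coprime_1_left mult_cancel_right2)
  have sub: "G \<subseteq> carrier (reduced_residues q)" by (rule subgroup.subset[OF assms(2)])
  then have gco: "coprime g (int q)" using g(1) R.res_units_eq by (auto simp: units_of_carrier)
  show ?thesis
  proof (rule extremal_barrier_from_character[where \<xi> = \<psi> and r = r])
    show "(\<lambda>a. \<psi> a ^ m) \<in> nonprincipal_characters q" if "0 < m" "m < r" for m
    proof -
      have "\<psi> g ^ m \<noteq> principal_character q g"
        using g(2)[OF that] gco by (simp add: principal_character_def)
      then have "(\<lambda>a. \<psi> a ^ m) \<noteq> principal_character q" by metis
      then show ?thesis
        using dirichlet_character_power[OF \<psi>(1) that(1)] by (simp add: nonprincipal_characters_def)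
    qed
    show "finite D"
      using assms(4,5,6) by (metis card.infinite finite_subset not_numeral_le_zero)
    show "\<psi> a ^ r = 1 \<and> \<psi> a \<noteq> 1" if "a \<in> D" for a
    proof -
      have "a \<in> G" "a \<noteq> 1" using that assms(6,7) by auto
      then show ?thesis using \<psi>(2,3) one \<psi>1 by (metis inj_onD)
    qed
    show "a = b" if "a \<in> D" "b \<in> D" "\<psi> b = \<psi> a \<or> \<psi> b = cnj (\<psi> a)" for a b
      using that(3)
    proof
      assume "\<psi> b = \<psi> a"
      then show ?thesis using \<psi>(2) that assms(6) by (metis inj_onD subsetD)
    next
      assume "\<psi> b = cnj (\<psi> a)"
      then have "\<psi> b = \<psi> (inv\<^bsub>reduced_residues q\<^esub> a)"
        using dirichlet_character_inverse[OF q \<psi>(1)] that(1) assms(6) sub by (metis subsetD)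
      moreover have "inv\<^bsub>reduced_residues q\<^esub> a \<in> G"
        using subgroup.m_inv_closed[OF assms(2)] that(1) assms(6) by blast
      ultimately have "b = inv\<^bsub>reduced_residues q\<^esub> a"
        using \<psi>(2) that(2) assms(6) by (metis inj_onD subsetD)
      then show ?thesis using assms(8)[OF that(1)] that(2) by metis
    qed
  qed (use q assms sub in auto)
qed

end
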